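(* Let $\Sigma$ be a fan in $N_{\mathbb{R}}$. Then the following are equivalent: (1) for any $P\in X_\Sigma^{\mathrm{cong}}$, there is a point $P_0$ of $X_\Sigma^{\mathrm{trop}}$ (regarded as a subspace of $X_\Sigma^{\mathrm{cong}}$) contained in the closure $\overline{\{P\}}$ of $\{P\}$ in $X_\Sigma^{\mathrm{cong}}$; (2) the fan $\Sigma$ is complete.
   Context: $\mathbb{T}=\mathbb{R}\cup\{-\infty\}$ is the semifield with $\oplus=\max$, $\odot=+$. A congruence on a commutative semiring $S$ is a subsemiring $C\subseteq S\times S$ which is an equivalence relation. It is prime if $(S\times S)\setminus C$ is nonempty and closed under $(a,b)\rtimes(c,d)=(ac+bd,ad+bc)$. $\operatorname{CSpec}S$ is the set of prime congruences with the topology whose closed sets are $V(C)=\{P\mid C\subseteq P\}$, $C$ a congruence. For a semiring $S$ with a fixed injective homomorphism $\mathbb{T}\to S$, $\operatorname{CSpec}_{\mathbb{T}}S\subseteq\operatorname{CSpec}S$ (subspace topology) is the set of prime congruences $P$ such that $\mathbb{T}\to S\to S/P$ is injective. $M,N$ are dual free abelian groups of rank $n$ with pairing $\langle\cdot,\cdot\rangle:M\times N\to\mathbb{Z}$; $M_{\mathbb R}=M\otimes\mathbb{R}$, $N_{\mathbb R}=N\otimes\mathbb{R}$. A cone is the set of nonnegative real combinations of a finite subset of $N$; it is strongly convex if $\sigma\cap-\sigma=\{0\}$. A fan $\Sigma$ is a (finite, nonempty) polyhedral complex in $N_{\mathbb{R}}$ consisting of strongly convex cones; it is complete if its cones cover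 $N_{\mathbb{R}}$. For a cone $\sigma$, $\sigma^\vee=\{m\in M_{\mathbb R}\mid\langle m,v\rangle\ge0\ \forall v\in\sigma\}$ and $\mathsf{M}_\sigma=\sigma^\vee\cap M$. $\mathbb{T}[\mathsf{M}_\sigma]$ is the monoid semiring of $\mathsf{M}_\sigma$ over $\mathbb{T}$ (finite formal $\mathbb{T}$-linear combinations of elements of $\mathsf{M}_\sigma$), a $\mathbb{T}$-algebra via constants. Set $U_\sigma^{\mathrm{cong}}=\operatorname{CSpec}_{\mathbb{T}}\mathbb{T}[\mathsf{M}_\sigma]$. For a face $\tau$ of $\sigma$, pulling back congruences along $\mathbb{T}[\mathsf{M}_\sigma]\hookrightarrow\mathbb{T}[\mathsf{M}_\tau]$ gives an open embedding $U_\tau^{\mathrm{cong}}\hookrightarrow U_\sigma^{\mathrm{cong}}$; $X_\Sigma^{\mathrm{cong}}$ is the topological space obtained by gluing the $U_\sigma^{\mathrm{cong}}$, $\sigma\in\Sigma$, along these maps. Set $U_\sigma^{\mathrm{trop}}=\operatorname{Hom}(\mathsf{M}_\sigma,\mathbb{T})$, the monoid homomorphisms $(\mathsf{M}_\sigma,+)\to(\mathbb{T},\odot)$; $X_\Sigma^{\mathrm{trop}}$ is obtained by gluing the $U_\sigma^{\mathrm{trop}}$ along the restriction maps $U_\tau^{\mathrm{trop}}\hookrightarrow U_\sigma^{\mathrm{trop}}$ for faces $\tau$ of $\sigma$. It is regarded as a subspace of $X_\Sigma^{\mathrm{cong}}$ via the injection glued from the maps $U_\sigma^{\mathrm{trop}}\to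 U_\sigma^{\mathrm{cong}}$ sending $\phi$ to the kernel congruence of the induced homomorphism $\mathbb{T}[\mathsf{M}_\sigma]\to\mathbb{T}$, $rm\mapsto r\odot\phi(m)$. (Equivalently, its points in the chart $U_\sigma^{\mathrm{cong}}$ are the geometric congruences, i.e. the $P$ for which $\mathbb{T}\to\mathbb{T}[\mathsf{M}_\sigma]\to\mathbb{T}[\mathsf{M}_\sigma]/P$ is an isomorphism.) *)

theory Defs
  imports "HOL-Analysis.Analysis" "HOL-Library.Poly_Mapping"
begin

section \<open>The tropical semifield\<close>

datatype trop = NegInf | Fin real

instantiation trop :: comm_semiring_1
begin

definition zero_trop :: trop where "0 = NegInf"

definition one_trop :: trop where "1 = Fin 0"

fun plus_trop :: "trop \<Rightarrow> trop \<Rightarrow> trop" where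
  "NegInf + b = b"
| "a + NegInf = a"
| "Fin x + Fin y = Fin (max x y)"

fun times_trop :: "trop \<Rightarrow> trop \<Rightarrow> trop" where
  "Fin x * Fin y = Fin (x + y)"
| "a * b = NegInf"

instance
proof
  fix a b c :: trop
  show "a + b + c = a + (b + c)" by (cases a; cases b; cases c) auto
  show "a + b = b + a" by (cases a; cases b) auto
  show "0 + a = a" by (simp add: zero_trop_def)
  show "a * b * c = a * (b * c)" by (cases a; cases b; cases c) auto
  show "a * b = b * a" by (cases a; cases b) auto
  show "1 * a = a" by (cases a) (auto simp: one_trop_def)
  show "(a + b) * c = a * c + b * c" by (cases a; cases b; cases c) auto
  show "0 * a = 0" by (simp add: zero_trop_def)
  show "a * 0 = 0" by (cases a) (auto simp: zero_trop_def)
  show "(0::trop) \<noteq> 1" by (simp add: zero_trop_def one_trop_def)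
qed

end


section \<open>Congruences\<close>

text \<open>Semirings are given as subsemirings \<open>S\<close> of an ambient type.\<close>

definition subsemiring :: "'a::comm_semiring_1 set \<Rightarrow> bool" where
  "subsemiring S \<longleftrightarrow> 0 \<in> S \<and> 1 \<in> S \<and> (\<forall>a\<in>S. \<forall>b\<in>S. a + b \<in> S \<and> a * b \<in> S)"

definition congruence :: "'a::comm_semiring_1 set \<Rightarrow> ('a \<times> 'a) set \<Rightarrow> bool" where
  "congruence S C \<longleftrightarrow> C \<subseteq> S \<times> S \<and> equiv S C \<and>
     (0, 0) \<in> C \<and> (1, 1) \<in> C \<and>
     (\<forall>a b c d. (a, b) \<in> C \<longrightarrow> (c, d) \<in> C \<longrightarrow> (a + c, b + d) \<in> C \<and> (a * c, b * d) \<in> C)"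

definition twisted_product :: "'a::comm_semiring_1 \<times> 'a \<Rightarrow> 'a \<times> 'a \<Rightarrow> 'a \<times> 'a" where
  "twisted_product x y =
     (fst x * fst y + snd x * snd y, fst x * snd y + snd x * fst y)"

definition prime_congruence :: "'a::comm_semiring_1 set \<Rightarrow> ('a \<times> 'a) set \<Rightarrow> bool" where
  "prime_congruence S C \<longleftrightarrow> congruence S C \<and> S \<times> S - C \<noteq> {} \<and>
     (\<forall>x\<in>S \<times> S - C. \<forall>y\<in>S \<times> S - C. twisted_product x y \<in> S \<times> S - C)"

definition CSpec :: "'a::comm_semiring_1 set \<Rightarrow> ('a \<times> 'a) set set" where
  "CSpec S = {P. prime_congruence S P}"

definition VC :: "'a::comm_semiring_1 set \<Rightarrow> ('a \<times> 'a) set \<Rightarrow> ('a \<times> 'a) set set" where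
  "VC S C = {P \<in> CSpec S. C \<subseteq> P}"

definition CSpec_topology :: "'a::comm_semiring_1 set \<Rightarrow> ('a \<times> 'a) set topology" where
  "CSpec_topology S =
     topology (\<lambda>U. U \<subseteq> CSpec S \<and> (\<exists>C. congruence S C \<and> CSpec S - U = VC S C))"

text \<open>The prime congruences \<open>P\<close> on \<open>S\<close> such that \<open>r \<mapsto> [\<iota> r]\<close>, from the base to \<open>S / P\<close>,
  is injective.\<close>

definition CSpecT :: "(trop \<Rightarrow> 'a::comm_semiring_1) \<Rightarrow> 'a set \<Rightarrow> ('a \<times> 'a) set set" where
  "CSpecT \<iota> S = {P \<in> CSpec S. inj (\<lambda>r. P `` {\<iota> r})}"

definition CSpecT_topology ::
    "(trop \<Rightarrow> 'a::comm_semiring_1) \<Rightarrow> 'a set \<Rightarrow> ('a \<times> 'a) set topology" where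
  "CSpecT_topology \<iota> S = subtopology (CSpec_topology S) (CSpecT \<iota> S)"

text \<open>The sets \<open>VC S C\<close> are the closed sets of a topology, so that
  \<open>CSpec_topology\<close> is not a junk value.\<close>

lemma congruence_total: "subsemiring S \<Longrightarrow> congruence S (S \<times> S)"
  by (auto simp: subsemiring_def congruence_def equiv_def refl_on_def sym_def trans_def)

lemma congruence_Id_on: "subsemiring S \<Longrightarrow> congruence S (Id_on S)"
  by (auto simp: subsemiring_def congruence_def equiv_def refl_on_def sym_def trans_def)

lemma
  assumes "congruence S C"
  shows congruence_refl: "a \<in> S \<Longrightarrow> (a, a) \<in> C"
    and congruence_sym: "(a, b) \<in> C \<Longrightarrow> (b, a) \<in> C"
    and congruence_add: "(a, b) \<in> C \<Longrightarrow> (c, d) \<in> C \<Longrightarrow> (a + c, b + d) \<in> C"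
    and congruence_mult: "(a, b) \<in> C \<Longrightarrow> (c, d) \<in> C \<Longrightarrow> (a * c, b * d) \<in> C"
  using assms unfolding congruence_def equiv_def by (blast dest: refl_onD symD)+

lemma congruence_Inter:
  assumes "\<C> \<noteq> {}" "\<And>C. C \<in> \<C> \<Longrightarrow> congruence S C"
  shows "congruence S (\<Inter>\<C>)"
proof -
  note C = assms(2)[unfolded congruence_def equiv_def]
  obtain C0 where C0: "C0 \<in> \<C>" using assms(1) by blast
  have sub: "\<Inter>\<C> \<subseteq> S \<times> S" using C[OF C0] C0 by blast
  moreover have "refl_on S (\<Inter>\<C>)" using C by (meson InterI refl_on_def)
  moreover have "sym (\<Inter>\<C>)" by (rule symI) (meson C InterD InterI symD)
  moreover have "trans (\<Inter>\<C>)" by (rule transI) (meson C InterD InterI transD)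
  moreover have "(0,0) \<in> \<Inter>\<C>" "(1,1) \<in> \<Inter>\<C>" using C by blast+
  moreover have "(a + c, b + d) \<in> \<Inter>\<C> \<and> (a * c, b * d) \<in> \<Inter>\<C>"
    if "(a, b) \<in> \<Inter>\<C>" "(c, d) \<in> \<Inter>\<C>" for a b c d
    using that C by (meson InterD InterI)
  ultimately show ?thesis unfolding congruence_def equiv_def by blast
qed

lemma VC_Int:
  assumes C: "congruence S C" and D: "congruence S D"
  shows "VC S (C \<inter> D) = VC S C \<union> VC S D"
proof -
  have "C \<subseteq> P \<or> D \<subseteq> P" if P: "prime_congruence S P" and sub: "C \<inter> D \<subseteq> P" for P
  proof (rule ccontr)
    assume "\<not> ?thesis"
    then obtain a b c d where ab: "(a,b) \<in> C" "(a,b) \<notin> P" and cd: "(c,d) \<in> D" "(c,d) \<notin> P"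
      by auto
    have S: "a \<in> S" "b \<in> S" "c \<in> S" "d \<in> S"
      using C D ab cd unfolding congruence_def by blast+
    have "twisted_product (a,b) (c,d) \<notin> P"
      using P ab(2) cd(2) S unfolding prime_congruence_def by blast
    moreover have "twisted_product (a,b) (c,d) \<in> C"
    proof -
      have "(b,a) \<in> C" "(c,c) \<in> C" "(d,d) \<in> C"
        using C ab S by (simp_all add: congruence_refl congruence_sym)
      then have "(a*c, b*c) \<in> C" "(b*d, a*d) \<in> C" using C ab by (simp_all add: congruence_mult)
      then have "(a*c + b*d, b*c + a*d) \<in> C" using C by (simp add: congruence_add)
      then show ?thesis by (simp add: twisted_product_def add.commute)
    qed
    moreover have "twisted_product (a,b) (c,d) \<in> D"
    proof -
      have "(d,c) \<in> D" "(a,a) \<in> D" "(b,b) \<in> D"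
        using D cd S by (simp_all add: congruence_refl congruence_sym)
      then have "(a*c, a*d) \<in> D" "(b*d, b*c) \<in> D" using D cd by (simp_all add: congruence_mult)
      then have "(a*c + b*d, a*d + b*c) \<in> D" using D by (simp add: congruence_add)
      then show ?thesis by (simp add: twisted_product_def)
    qed
    ultimately show False using sub by auto
  qed
  then show ?thesis by (auto simp: VC_def CSpec_def)
qed

lemma openin_CSpec_topology:
  assumes S: "subsemiring S"
  shows "openin (CSpec_topology S) U \<longleftrightarrow>
    U \<subseteq> CSpec S \<and> (\<exists>C. congruence S C \<and> CSpec S - U = VC S C)"
proof -
  let ?P = "\<lambda>U. U \<subseteq> CSpec S \<and> (\<exists>C. congruence S C \<and> CSpec S - U = VC S C)"
  have "istopology ?P"
    unfolding istopology_def
  proof (intro conjI allI impI)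
    fix U V assume U: "?P U" and V: "?P V"
    then obtain C D where *: "congruence S C" "congruence S D"
      "CSpec S - U = VC S C" "CSpec S - V = VC S D" by blast
    have "CSpec S - U \<inter> V = VC S (C \<inter> D)"
      using * by (simp add: VC_Int Diff_Int)
    moreover have "congruence S (C \<inter> D)"
      using congruence_Inter[of "{C,D}" S] *(1,2) by fastforce
    ultimately show "\<exists>E. congruence S E \<and> CSpec S - U \<inter> V = VC S E" by metis
    show "U \<inter> V \<subseteq> CSpec S" using conjunct1[OF U] by (rule le_infI1)
  next
    fix \<U> assume \<U>: "\<forall>U\<in>\<U>. ?P U"
    show "\<Union>\<U> \<subseteq> CSpec S"
      by (intro Union_least, rule conjunct1, rule bspec[OF \<U>])
    have "\<forall>U\<in>\<U>. \<exists>C. congruence S C \<and> CSpec S - U = VC S C"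
      by (rule ballI, rule conjunct2, rule bspec[OF \<U>])
    from bchoice[OF this] obtain F
      where "\<forall>U\<in>\<U>. congruence S (F U) \<and> CSpec S - U = VC S (F U)" by (elim exE)
    then have F: "congruence S (F U) \<and> CSpec S - U = VC S (F U)" if "U \<in> \<U>" for U
      using that by (rule bspec)
    have ne: "A \<noteq> {}" if "x \<in> A" for x and A :: "('a \<times> 'a) set set" using that by auto
    let ?\<C> = "{E. congruence S E \<and> (\<forall>U\<in>\<U>. F U \<subseteq> E)}"
    have FS: "F U \<subseteq> S \<times> S" if "U \<in> \<U>" for U
      using F[OF that] by (simp add: congruence_def)
    have "S \<times> S \<in> ?\<C>" using FS congruence_total[OF S] by simp
    then have "?\<C> \<noteq> {}" by (rule ne)
    then have "congruence S (\<Inter>?\<C>)" by (rule congruence_Inter) simp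
    moreover have "CSpec S - \<Union>\<U> = VC S (\<Inter>?\<C>)"
    proof (rule set_eqI)
      fix P
      have le: "F U \<subseteq> \<Inter>?\<C>" if "U \<in> \<U>" for U
        by (rule Inter_greatest) (simp add: that)
      have cl: "P \<notin> U \<longleftrightarrow> F U \<subseteq> P" if "P \<in> CSpec S" "U \<in> \<U>" for U
      proof -
        have "P \<in> CSpec S - U \<longleftrightarrow> P \<in> VC S (F U)" using F[OF that(2)] by simp
        then show ?thesis using that(1) by (simp add: VC_def)
      qed
      show "P \<in> CSpec S - \<Union>\<U> \<longleftrightarrow> P \<in> VC S (\<Inter>?\<C>)"
      proof
        assume P: "P \<in> CSpec S - \<Union>\<U>"
        then have "congruence S P" by (simp add: CSpec_def prime_congruence_def)
        then have "P \<in> ?\<C>" using P cl by simp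
        then have "\<Inter>?\<C> \<subseteq> P" by (rule Inter_lower)
        then show "P \<in> VC S (\<Inter>?\<C>)" using P by (simp add: VC_def)
      next
        assume P: "P \<in> VC S (\<Inter>?\<C>)"
        then have "P \<in> CSpec S" "\<Inter>?\<C> \<subseteq> P" by (simp_all add: VC_def)
        have "P \<notin> U" if "U \<in> \<U>" for U
          using cl[OF \<open>P \<in> CSpec S\<close> that] subset_trans[OF le[OF that] \<open>\<Inter>?\<C> \<subseteq> P\<close>] by (rule iffD2)
        then show "P \<in> CSpec S - \<Union>\<U>" using \<open>P \<in> CSpec S\<close> by simp
      qed
    qed
    ultimately show "\<exists>E. congruence S E \<and> CSpec S - \<Union>\<U> = VC S E"
      by (intro exI[of _ "\<Inter>?\<C>"] conjI)
  qed
  then show ?thesis by (simp add: CSpec_topology_def)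
qed

lemma topspace_CSpec_topology:
  assumes "subsemiring S" shows "topspace (CSpec_topology S) = CSpec S"
proof -
  have "CSpec S - CSpec S = VC S (S \<times> S)"
    by (auto simp: VC_def CSpec_def prime_congruence_def congruence_def)
  then have "openin (CSpec_topology S) (CSpec S)"
    using openin_CSpec_topology[OF assms] congruence_total[OF assms] by blast
  then show ?thesis
    using openin_CSpec_topology[OF assms] unfolding topspace_def by blast
qed


section \<open>Gluing\<close>

text \<open>Charts \<open>U i\<close> (\<open>i \<in> I\<close>) and, whenever \<open>le i j\<close>, a transition map \<open>f i j\<close> from \<open>U i\<close> to
  \<open>U j\<close>. The glued set is the quotient of the disjoint union by the equivalence relation
  generated by \<open>(i, x) \<sim> (j, f i j x)\<close>.\<close>

definition glue_step :: "'i set \<Rightarrow> ('i \<Rightarrow> 'i \<Rightarrow> bool) \<Rightarrow> ('i \<Rightarrow> 'i \<Rightarrow> 'a \<Rightarrow> 'a) \<Rightarrow> ('i \<Rightarrow> 'a set)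
    \<Rightarrow> (('i \<times> 'a) \<times> ('i \<times> 'a)) set" where
  "glue_step I le f U =
     {((i, x), (j, y)). i \<in> I \<and> j \<in> I \<and> le i j \<and> x \<in> U i \<and> y \<in> U j \<and> y = f i j x}"

definition glue_rel :: "'i set \<Rightarrow> ('i \<Rightarrow> 'i \<Rightarrow> bool) \<Rightarrow> ('i \<Rightarrow> 'i \<Rightarrow> 'a \<Rightarrow> 'a) \<Rightarrow> ('i \<Rightarrow> 'a set)
    \<Rightarrow> (('i \<times> 'a) \<times> ('i \<times> 'a)) set" where
  "glue_rel I le f U =
     (glue_step I le f U \<union> (glue_step I le f U)\<inverse>)\<^sup>* \<inter> Sigma I U \<times> Sigma I U"

definition glue :: "'i set \<Rightarrow> ('i \<Rightarrow> 'i \<Rightarrow> bool) \<Rightarrow> ('i \<Rightarrow> 'i \<Rightarrow> 'a \<Rightarrow> 'a) \<Rightarrow> ('i \<Rightarrow> 'a set)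
    \<Rightarrow> ('i \<times> 'a) set set" where
  "glue I le f U = Sigma I U // glue_rel I le f U"

lemma equiv_glue_rel: "equiv (Sigma I U) (glue_rel I le f U)"
proof (rule equivI)
  let ?R = "glue_step I le f U \<union> (glue_step I le f U)\<inverse>"
  show "refl_on (Sigma I U) (glue_rel I le f U)" by (auto simp: refl_on_def glue_rel_def)
  have "sym (?R\<^sup>*)" by (intro sym_rtrancl) (auto simp: sym_def)
  then show "sym (glue_rel I le f U)" by (auto simp: glue_rel_def sym_def)
  show "trans (glue_rel I le f U)"
    unfolding glue_rel_def by (rule transI) (auto intro: rtrancl_trans)
qed (auto simp: glue_rel_def)

text \<open>The quotient topology on a set \<open>Q\<close> of (disjoint) classes.\<close>

definition quotient_topology :: "'a topology \<Rightarrow> 'a set set \<Rightarrow> 'a set topology" where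
  "quotient_topology X Q = topology (\<lambda>V. V \<subseteq> Q \<and> openin X (\<Union>V))"

lemma openin_quotient_topology:
  assumes "equiv (topspace X) R"
  shows "openin (quotient_topology X (topspace X // R)) V \<longleftrightarrow>
    V \<subseteq> topspace X // R \<and> openin X (\<Union>V)"
proof -
  let ?Q = "topspace X // R"
  have "istopology (\<lambda>V. V \<subseteq> ?Q \<and> openin X (\<Union>V))"
    unfolding istopology_def
  proof (intro conjI allI impI)
    fix V W assume V: "V \<subseteq> ?Q \<and> openin X (\<Union>V)" and W: "W \<subseteq> ?Q \<and> openin X (\<Union>W)"
    show "V \<inter> W \<subseteq> ?Q" using V by blast
    have "c = d" if "c \<in> V" "d \<in> W" "x \<in> c" "x \<in> d" for c d x
      using quotient_disj[OF assms, of c d] V W that by blast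
    then have "\<Union>(V \<inter> W) = \<Union>V \<inter> \<Union>W" by blast
    then show "openin X (\<Union>(V \<inter> W))" using V W by auto
  next
    fix \<V> assume *: "\<forall>V\<in>\<V>. V \<subseteq> ?Q \<and> openin X (\<Union>V)"
    then show "\<Union>\<V> \<subseteq> ?Q" by blast
    have "\<Union>(\<Union>\<V>) = (\<Union>V\<in>\<V>. \<Union>V)" by blast
    then show "openin X (\<Union>(\<Union>\<V>))" using * by auto
  qed
  then show ?thesis by (simp add: quotient_topology_def)
qed


section \<open>Lattices, cones and fans\<close>

text \<open>\<open>M\<close> and \<open>N\<close> are dual free abelian groups of rank \<open>n\<close>, realised inside their real
  extensions, which are the types \<open>'w\<close> and \<open>'v\<close>; \<open>p\<close> is the pairing extended to these. Duality
  is expressed by a pair of dual bases. Real linear independence of \<open>e\<close> and \<open>f\<close> follows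
  from the pairing condition, and \<open>n = 0\<close> is allowed.\<close>

definition dual_lattices ::
    "nat \<Rightarrow> ('w::real_vector \<Rightarrow> 'v::real_vector \<Rightarrow> real) \<Rightarrow> 'w set \<Rightarrow> 'v set \<Rightarrow> bool" where
  "dual_lattices n p M N \<longleftrightarrow> bilinear p \<and>
     (\<exists>e f. M = {\<Sum>i<n. of_int (k i) *\<^sub>R e i | k :: nat \<Rightarrow> int. True} \<and>
            N = {\<Sum>i<n. of_int (k i) *\<^sub>R f i | k :: nat \<Rightarrow> int. True} \<and>
            span M = UNIV \<and> span N = UNIV \<and>
            (\<forall>i<n. \<forall>j<n. p (e i) (f j) = (if i = j then 1 else 0)))"

definition rational_cone :: "'v::real_vector set \<Rightarrow> 'v set \<Rightarrow> bool" where
  "rational_cone N \<sigma> \<longleftrightarrow>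
     (\<exists>G. finite G \<and> G \<subseteq> N \<and> \<sigma> = {\<Sum>g\<in>G. c g *\<^sub>R g | c. \<forall>g\<in>G. 0 \<le> c g})"

definition strongly_convex :: "'v::real_vector set \<Rightarrow> bool" where
  "strongly_convex \<sigma> \<longleftrightarrow> \<sigma> \<inter> uminus ` \<sigma> = {0}"

definition dual_cone :: "('w \<Rightarrow> 'v \<Rightarrow> real) \<Rightarrow> 'v set \<Rightarrow> 'w set" where
  "dual_cone p \<sigma> = {u. \<forall>v\<in>\<sigma>. 0 \<le> p u v}"

text \<open>Faces in the sense of toric geometry: \<open>\<sigma> \<inter> u\<^sup>\<bottom>\<close> with \<open>u\<close> in the dual cone. The library's
  \<open>face_of\<close> would also admit the empty face.\<close>

definition cone_face :: "('w \<Rightarrow> 'v \<Rightarrow> real) \<Rightarrow> 'v set \<Rightarrow> 'v set \<Rightarrow> bool" where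
  "cone_face p \<tau> \<sigma> \<longleftrightarrow> (\<exists>u\<in>dual_cone p \<sigma>. \<tau> = {v \<in> \<sigma>. p u v = 0})"

definition fan :: "('w::real_vector \<Rightarrow> 'v::real_vector \<Rightarrow> real) \<Rightarrow> 'v set \<Rightarrow> 'v set set \<Rightarrow> bool" where
  "fan p N \<Sigma> \<longleftrightarrow> finite \<Sigma> \<and> \<Sigma> \<noteq> {} \<and>
     (\<forall>\<sigma>\<in>\<Sigma>. rational_cone N \<sigma> \<and> strongly_convex \<sigma>) \<and>
     (\<forall>\<sigma>\<in>\<Sigma>. \<forall>\<tau>. cone_face p \<tau> \<sigma> \<longrightarrow> \<tau> \<in> \<Sigma>) \<and>
     (\<forall>\<sigma>\<in>\<Sigma>. \<forall>\<sigma>'\<in>\<Sigma>. cone_face p (\<sigma> \<inter> \<sigma>') \<sigma> \<and> cone_face p (\<sigma> \<inter> \<sigma>') \<sigma>')"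

definition complete_fan :: "'v set set \<Rightarrow> bool" where
  "complete_fan \<Sigma> \<longleftrightarrow> \<Union>\<Sigma> = UNIV"

definition cone_monoid :: "('w \<Rightarrow> 'v \<Rightarrow> real) \<Rightarrow> 'w set \<Rightarrow> 'v set \<Rightarrow> 'w set" where
  "cone_monoid p M \<sigma> = dual_cone p \<sigma> \<inter> M"


section \<open>Monoid semirings over the tropical semifield\<close>

text \<open>\<open>\<T>[A]\<close> for a submonoid \<open>A\<close> of \<open>'w\<close>, inside the monoid semiring
  \<open>'w \<Rightarrow>\<^sub>0 trop\<close> with its convolution product.\<close>

definition monoid_semiring :: "'w::comm_monoid_add set \<Rightarrow> ('w \<Rightarrow>\<^sub>0 trop) set" where
  "monoid_semiring A = {F. Poly_Mapping.keys F \<subseteq> A}"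

definition trop_const :: "trop \<Rightarrow> ('w::comm_monoid_add \<Rightarrow>\<^sub>0 trop)" where
  "trop_const r = Poly_Mapping.single 0 r"

lemma subsemiring_monoid_semiring:
  assumes "0 \<in> A" "\<And>a b. a \<in> A \<Longrightarrow> b \<in> A \<Longrightarrow> a + b \<in> A"
  shows "subsemiring (monoid_semiring A)"
proof -
  have "Poly_Mapping.keys (F + G) \<subseteq> A" "Poly_Mapping.keys (F * G) \<subseteq> A"
    if "Poly_Mapping.keys F \<subseteq> A" "Poly_Mapping.keys G \<subseteq> A" for F G :: "'a \<Rightarrow>\<^sub>0 trop"
    using that Poly_Mapping.keys_add[of F G] keys_mult[of F G] assms(2) by blast+
  then show ?thesis using assms(1) by (auto simp: subsemiring_def monoid_semiring_def)
qed

lemma subsemiring_cone: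
  assumes "dual_lattices n p M N"
  shows "subsemiring (monoid_semiring (cone_monoid p M \<sigma>))"
proof (rule subsemiring_monoid_semiring)
  obtain e where bil: "bilinear p"
    and M: "M = {\<Sum>i<n. of_int (k i) *\<^sub>R e i | k :: nat \<Rightarrow> int. True}"
    using assms by (auto simp: dual_lattices_def)
  have "0 \<in> M" unfolding M by (rule CollectI, rule exI[of _ "\<lambda>_. 0"]) simp
  then show "0 \<in> cone_monoid p M \<sigma>"
    using bil by (simp add: cone_monoid_def dual_cone_def bilinear_lzero)
  fix a b assume ab: "a \<in> cone_monoid p M \<sigma>" "b \<in> cone_monoid p M \<sigma>"
  then obtain k l where "a = (\<Sum>i<n. of_int (k i) *\<^sub>R e i)" "b = (\<Sum>i<n. of_int (l i) *\<^sub>R e i)"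
    by (auto simp: cone_monoid_def M)
  then have "a + b = (\<Sum>i<n. of_int (k i + l i) *\<^sub>R e i)"
    by (simp add: scaleR_add_left sum.distrib)
  then have "a + b \<in> M"
    unfolding M by (intro CollectI exI[of _ "\<lambda>i. k i + l i"] conjI TrueI)
  then show "a + b \<in> cone_monoid p M \<sigma>"
    using ab bil by (auto simp: cone_monoid_def dual_cone_def bilinear_ladd)
qed


section \<open>The congruence toric space\<close>

definition U_cong :: "('w::real_vector \<Rightarrow> 'v::real_vector \<Rightarrow> real) \<Rightarrow> 'w set \<Rightarrow> 'v set
    \<Rightarrow> (('w \<Rightarrow>\<^sub>0 trop) \<times> ('w \<Rightarrow>\<^sub>0 trop)) set set" where
  "U_cong p M \<sigma> = CSpecT trop_const (monoid_semiring (cone_monoid p M \<sigma>))"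

definition U_cong_topology :: "('w::real_vector \<Rightarrow> 'v::real_vector \<Rightarrow> real) \<Rightarrow> 'w set \<Rightarrow> 'v set
    \<Rightarrow> (('w \<Rightarrow>\<^sub>0 trop) \<times> ('w \<Rightarrow>\<^sub>0 trop)) set topology" where
  "U_cong_topology p M \<sigma> =
     CSpecT_topology trop_const (monoid_semiring (cone_monoid p M \<sigma>))"

text \<open>Pulling back along the inclusion \<open>\<T>[M\<^sub>\<sigma>] \<subseteq> \<T>[M\<^sub>\<tau>]\<close> is intersecting with
  \<open>\<T>[M\<^sub>\<sigma>] \<times> \<T>[M\<^sub>\<sigma>]\<close>.\<close>

definition pullback_cong :: "('w::real_vector \<Rightarrow> 'v::real_vector \<Rightarrow> real) \<Rightarrow> 'w set
    \<Rightarrow> 'v set \<Rightarrow> 'v set \<Rightarrow> (('w \<Rightarrow>\<^sub>0 trop) \<times> ('w \<Rightarrow>\<^sub>0 trop)) set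
    \<Rightarrow> (('w \<Rightarrow>\<^sub>0 trop) \<times> ('w \<Rightarrow>\<^sub>0 trop)) set" where
  "pullback_cong p M \<tau> \<sigma> P =
     P \<inter> monoid_semiring (cone_monoid p M \<sigma>) \<times> monoid_semiring (cone_monoid p M \<sigma>)"

definition X_cong_rel where
  "X_cong_rel p M \<Sigma> = glue_rel \<Sigma> (cone_face p) (pullback_cong p M) (U_cong p M)"

definition X_cong_points where
  "X_cong_points p M \<Sigma> = glue \<Sigma> (cone_face p) (pullback_cong p M) (U_cong p M)"

definition X_cong :: "('w::real_vector \<Rightarrow> 'v::real_vector \<Rightarrow> real) \<Rightarrow> 'w set \<Rightarrow> 'v set set
    \<Rightarrow> ('v set \<times> (('w \<Rightarrow>\<^sub>0 trop) \<times> ('w \<Rightarrow>\<^sub>0 trop)) set) set topology" where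
  "X_cong p M \<Sigma> =
     quotient_topology (sum_topology (U_cong_topology p M) \<Sigma>) (X_cong_points p M \<Sigma>)"

lemma topspace_U_cong_topology:
  assumes "dual_lattices n p M N"
  shows "topspace (U_cong_topology p M \<sigma>) = U_cong p M \<sigma>"
  using topspace_CSpec_topology[OF subsemiring_cone[OF assms]]
  by (auto simp: U_cong_topology_def U_cong_def CSpecT_topology_def CSpecT_def)

lemma openin_X_cong:
  assumes "dual_lattices n p M N"
  shows "openin (X_cong p M \<Sigma>) V \<longleftrightarrow>
    V \<subseteq> X_cong_points p M \<Sigma> \<and> openin (sum_topology (U_cong_topology p M) \<Sigma>) (\<Union>V)"
proof -
  have "topspace (sum_topology (U_cong_topology p M) \<Sigma>) = Sigma \<Sigma> (U_cong p M)"
    by (simp add: topspace_U_cong_topology[OF assms] o_def)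
  then show ?thesis
    using openin_quotient_topology[of "sum_topology (U_cong_topology p M) \<Sigma>"] equiv_glue_rel
    unfolding X_cong_def X_cong_points_def glue_def by metis
qed

lemma topspace_X_cong:
  assumes "dual_lattices n p M N"
  shows "topspace (X_cong p M \<Sigma>) = X_cong_points p M \<Sigma>"
proof -
  have "\<Union>(X_cong_points p M \<Sigma>) = topspace (sum_topology (U_cong_topology p M) \<Sigma>)"
    unfolding X_cong_points_def glue_def
    by (simp add: Union_quotient[OF equiv_glue_rel] topspace_U_cong_topology[OF assms] o_def)
  then have "openin (X_cong p M \<Sigma>) (X_cong_points p M \<Sigma>)"
    using openin_X_cong[OF assms] openin_topspace[of "sum_topology (U_cong_topology p M) \<Sigma>"]
    by (metis subset_refl)
  then show ?thesis
    using openin_X_cong[OF assms] unfolding topspace_def by blast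
qed


section \<open>The tropical toric variety\<close>

text \<open>Monoid homomorphisms \<open>(A, +) \<rightarrow> (\<T>, \<odot>)\<close>, as functions that are
  \<open>undefined\<close> outside \<open>A\<close>, so that distinct functions are distinct homomorphisms.\<close>

definition trop_hom :: "'w::comm_monoid_add set \<Rightarrow> ('w \<Rightarrow> trop) set" where
  "trop_hom A = {\<phi> \<in> extensional A. \<phi> 0 = 1 \<and> (\<forall>a\<in>A. \<forall>b\<in>A. \<phi> (a + b) = \<phi> a * \<phi> b)}"

definition U_trop :: "('w::real_vector \<Rightarrow> 'v::real_vector \<Rightarrow> real) \<Rightarrow> 'w set \<Rightarrow> 'v set
    \<Rightarrow> ('w \<Rightarrow> trop) set" where
  "U_trop p M \<sigma> = trop_hom (cone_monoid p M \<sigma>)"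

definition restrict_trop :: "('w::real_vector \<Rightarrow> 'v::real_vector \<Rightarrow> real) \<Rightarrow> 'w set
    \<Rightarrow> 'v set \<Rightarrow> 'v set \<Rightarrow> ('w \<Rightarrow> trop) \<Rightarrow> ('w \<Rightarrow> trop)" where
  "restrict_trop p M \<tau> \<sigma> \<phi> = restrict \<phi> (cone_monoid p M \<sigma>)"

definition X_trop :: "('w::real_vector \<Rightarrow> 'v::real_vector \<Rightarrow> real) \<Rightarrow> 'w set \<Rightarrow> 'v set set
    \<Rightarrow> ('v set \<times> ('w \<Rightarrow> trop)) set set" where
  "X_trop p M \<Sigma> = glue \<Sigma> (cone_face p) (restrict_trop p M) (U_trop p M)"

text \<open>The homomorphism \<open>\<T>[A] \<rightarrow> \<T>\<close> induced by \<open>\<phi>\<close>; the sum is the tropical one.\<close>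

definition eval_trop :: "('w \<Rightarrow> trop) \<Rightarrow> ('w \<Rightarrow>\<^sub>0 trop) \<Rightarrow> trop" where
  "eval_trop \<phi> F = (\<Sum>m\<in>Poly_Mapping.keys F. Poly_Mapping.lookup F m * \<phi> m)"

definition kernel_cong :: "('w::real_vector \<Rightarrow> 'v::real_vector \<Rightarrow> real) \<Rightarrow> 'w set \<Rightarrow> 'v set
    \<Rightarrow> ('w \<Rightarrow> trop) \<Rightarrow> (('w \<Rightarrow>\<^sub>0 trop) \<times> ('w \<Rightarrow>\<^sub>0 trop)) set" where
  "kernel_cong p M \<sigma> \<phi> =
     {(F, G). F \<in> monoid_semiring (cone_monoid p M \<sigma>) \<and>
              G \<in> monoid_semiring (cone_monoid p M \<sigma>) \<and> eval_trop \<phi> F = eval_trop \<phi> G}"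

text \<open>The glued map sends the class \<open>x\<close> of \<open>(\<sigma>, \<phi>)\<close> to the class of \<open>(\<sigma>, kernel_cong p M \<sigma> \<phi>)\<close>,
  which is independent of the representative; it is written as the set of all pairs related to
  the kernel congruence of some representative.\<close>

definition trop_to_cong :: "('w::real_vector \<Rightarrow> 'v::real_vector \<Rightarrow> real) \<Rightarrow> 'w set \<Rightarrow> 'v set set
    \<Rightarrow> ('v set \<times> ('w \<Rightarrow> trop)) set
    \<Rightarrow> ('v set \<times> (('w \<Rightarrow>\<^sub>0 trop) \<times> ('w \<Rightarrow>\<^sub>0 trop)) set) set" where
  "trop_to_cong p M \<Sigma> x = X_cong_rel p M \<Sigma> `` ((\<lambda>(\<sigma>, \<phi>). (\<sigma>, kernel_cong p M \<sigma> \<phi>)) ` x)"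

end

theory Submission
  imports Defs "HOL-Analysis.Kronecker_Approximation_Theorem"
begin

text \<open>A prime congruence \<open>P\<close> on \<open>\<T>[M\<^sub>\<sigma>]\<close> makes the quotient a totally ordered cancellative semiring
  (\<open>tropical_prime.le_total\<close>). Suppose that modulo \<open>P\<close> every monomial lies below some real
  constant. Then sending a polynomial to the infimum of the constants above it is a homomorphism
  to \<open>\<T>\<close>, and its kernel is a tropical point that contains \<open>P\<close>, that is, lies in the closure
  of \<open>P\<close> (\<open>bounded_point_below_kernel_cong\<close>, \<open>X_cong_class_in_closure\<close>). So the question is
  whether each point has a chart in which all monomials are bounded.

  Let \<open>\<Sigma>\<close> be complete. The monomials of \<open>M\<^sub>\<sigma>\<close> that are nonzero modulo \<open>P\<close> are those
  perpendicular to some face \<open>\<tau>\<close> of \<open>\<sigma>\<close>, and localising at one of them extends \<open>P\<close> to the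
  chart of \<open>\<tau>\<close> (\<open>point_extends_to_face\<close>). From there it restricts to the chart of each cone
  \<open>\<sigma>' \<supseteq> \<tau>\<close> of \<open>\<Sigma>\<close>. If none of these charts had only bounded monomials, each would contribute an
  exponent that is infinitely large modulo \<open>P\<close>. Infinitely large exponents satisfy no
  nontrivial relation with nonnegative integral coefficients, hence none with real ones, so by
  Gordan's theorem they are all positive on some \<open>v\<close>. For \<open>w\<close> in the relative interior of
  \<open>\<tau>\<close> and small \<open>\<epsilon> > 0\<close> the point \<open>w - \<epsilon> v\<close> then lies in no cone at all
  (\<open>complete_fan_cone_with_bounded_monomials\<close>).

  Conversely, let \<open>v\<close> lie in no cone. Comparing polynomials first by their slope in the direction
  \<open>- v\<close> and then by their constant term gives a point that is defined in all charts at once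
  (\<open>ray_congruence\<close>). By Farkas' lemma, every \<open>M\<^sub>\<sigma>\<close> has an element that is negative on \<open>v\<close>; its
  monomial exceeds all constants and would have to take the value \<open>+\<infinity>\<close> at a tropical point
  of the closure. That the closure sees no more than these inclusions of congruences is
  \<open>closure_of_compatible_family\<close>.

  The passage from real to integral data is needed twice: a face of a rational cone, and a point
  outside of it, are cut off by elements of \<open>M\<close>, and a nonnegative relation between elements of
  \<open>M\<close> can be made integral. Both follow from
  Dirichlet's theorem on simultaneous approximation, since an integer of absolute value less
  than \<open>1\<close> is \<open>0\<close>.\<close>

section \<open>Theorems of the alternative\<close>

locale nondegenerate_pairing =
  fixes p :: "'x::real_vector \<Rightarrow> 'y::real_vector \<Rightarrow> real"
  assumes bilinear: "bilinear p"
    and nondegenerate_left: "(\<And>y. p x y = 0) \<Longrightarrow> x = 0"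
    and nondegenerate_right: "(\<And>x. p x y = 0) \<Longrightarrow> y = 0"
begin

lemma linear_left: "linear (\<lambda>x. p x y)" and linear_right: "linear (p x)"
  using bilinear by (auto simp: bilinear_def)

lemmas pairing_simps =
  bilinear_ladd[OF bilinear] bilinear_radd[OF bilinear]
  bilinear_lmul[OF bilinear] bilinear_rmul[OF bilinear]
  bilinear_lneg[OF bilinear] bilinear_rneg[OF bilinear]
  bilinear_lzero[OF bilinear] bilinear_rzero[OF bilinear]
  bilinear_lsub[OF bilinear] bilinear_rsub[OF bilinear]
  linear_sum[OF linear_left] linear_sum[OF linear_right]

text \<open>Induction on the number of generators (Bartl's algebraic proof). If \<open>g i\<close> is really
  needed, some \<open>z\<close> is nonnegative on the other generators and negative on \<open>b\<close>, hence on
  \<open>g i\<close>; projecting everything along \<open>g i\<close> onto the hyperplane \<open>p z = 0\<close>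
  leaves one generator fewer.\<close>

lemma Farkas:
  assumes "finite I"
    and "\<And>x. (\<And>i. i \<in> I \<Longrightarrow> 0 \<le> p x (g i)) \<Longrightarrow> 0 \<le> p x b"
  obtains c where "\<And>i. i \<in> I \<Longrightarrow> 0 \<le> c i" "b = (\<Sum>i\<in>I. c i *\<^sub>R g i)"
proof -
  have "\<exists>c. (\<forall>i\<in>I. 0 \<le> c i) \<and> b = (\<Sum>i\<in>I. c i *\<^sub>R g i)"
    using assms
  proof (induction I arbitrary: g b rule: finite_induct)
    case empty
    have "p x b = 0" for x
      using empty[of x] empty[of "- x"] by (simp add: pairing_simps)
    then show ?case using nondegenerate_right by auto
  next
    case (insert i I)
    show ?case
    proof (cases "\<forall>x. (\<forall>j\<in>I. 0 \<le> p x (g j)) \<longrightarrow> 0 \<le> p x b")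
      case True
      then obtain c where c: "\<forall>j\<in>I. 0 \<le> c j" "b = (\<Sum>j\<in>I. c j *\<^sub>R g j)"
        using insert.IH[of g b] by auto
      have "(\<Sum>j\<in>insert i I. (c(i := 0)) j *\<^sub>R g j) = (\<Sum>j\<in>I. c j *\<^sub>R g j)"
        using insert.hyps by (auto intro!: sum.cong)
      then show ?thesis
        using c by (intro exI[of _ "c(i := 0)"]) auto
    next
      case False
      then obtain z0 where z0: "\<And>j. j \<in> I \<Longrightarrow> 0 \<le> p z0 (g j)" "p z0 b < 0"
        by (meson not_le)
      have neg: "p z0 (g i) < 0"
        using insert.prems[of z0] z0 by (metis insert_iff not_le)
      define z where "z = (- 1 / p z0 (g i)) *\<^sub>R z0"
      have z: "p z (g i) = - 1" "\<And>j. j \<in> I \<Longrightarrow> 0 \<le> p z (g j)" "p z b < 0"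
        using z0 neg by (auto simp: z_def pairing_simps divide_simps zero_le_mult_iff)
      define g' where "g' j = g j + p z (g j) *\<^sub>R g i" for j
      define b' where "b' = b + p z b *\<^sub>R g i"
      have "0 \<le> p x b'" if x: "\<And>j. j \<in> I \<Longrightarrow> 0 \<le> p x (g' j)" for x
      proof -
        define y where "y = x + p x (g i) *\<^sub>R z"
        have "0 \<le> p y (g j)" if "j \<in> insert i I" for j
          using that x[of j] z(1)
          by (auto simp: y_def g'_def pairing_simps algebra_simps)
        then have "0 \<le> p y b" by (rule insert.prems)
        then show ?thesis
          by (simp add: y_def b'_def pairing_simps algebra_simps)
      qed
      then obtain c where c: "\<forall>j\<in>I. 0 \<le> c j" "b' = (\<Sum>j\<in>I. c j *\<^sub>R g' j)"
        using insert.IH[of g' b'] by blast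
      define a where "a = (\<Sum>j\<in>I. c j * p z (g j)) - p z b"
      have "0 \<le> a"
        using c(1) z by (simp add: a_def sum_nonneg add_nonneg_nonneg order.strict_implies_order
            order_trans[OF _ sum_nonneg])
      have "b = a *\<^sub>R g i + (\<Sum>j\<in>I. c j *\<^sub>R g j)"
        using c(2) by (simp add: a_def b'_def g'_def scaleR_add_right sum.distrib
            scaleR_sum_left[symmetric] algebra_simps)
      moreover have "(\<Sum>j\<in>insert i I. (c(i := a)) j *\<^sub>R g j) = a *\<^sub>R g i + (\<Sum>j\<in>I. c j *\<^sub>R g j)"
        using insert.hyps by (auto intro!: sum.cong)
      ultimately show ?thesis
        using c(1) \<open>0 \<le> a\<close> by (intro exI[of _ "c(i := a)"]) auto
    qed
  qed
  then show ?thesis using that by blast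
qed

text \<open>Append a coordinate \<open>1\<close> to every \<open>m i\<close>: a nontrivial nonnegative relation between
  the \<open>m i\<close> is a representation of \<open>(0, 1)\<close>, and a functional that separates
  \<open>(0, 1)\<close> from the lifted vectors is positive on all the \<open>m i\<close>.\<close>

lemma Gordan:
  assumes "finite I"
    and no_relation: "\<And>c j. (\<And>i. i \<in> I \<Longrightarrow> 0 \<le> c i) \<Longrightarrow> (\<Sum>i\<in>I. c i *\<^sub>R m i) = 0
      \<Longrightarrow> j \<in> I \<Longrightarrow> 0 < c j \<Longrightarrow> False"
  obtains v where "\<And>i. i \<in> I \<Longrightarrow> 0 < p (m i) v"
proof -
  define q :: "'y \<times> real \<Rightarrow> 'x \<times> real \<Rightarrow> real"
    where "q y x = p (fst x) (fst y) + snd y * snd x" for x y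
  interpret lifted: nondegenerate_pairing q
  proof
    show "bilinear q"
      unfolding bilinear_def
      by (auto intro!: linearI simp: q_def pairing_simps algebra_simps)
  next
    fix y assume *: "\<And>x. q y x = 0"
    have "fst y = 0" by (rule nondegenerate_right) (use *[of "(_, 0)"] in \<open>simp add: q_def\<close>)
    moreover have "snd y = 0" using *[of "(0, 1)"] by (simp add: q_def pairing_simps)
    ultimately show "y = 0" by (simp add: prod_eq_iff)
  next
    fix x assume *: "\<And>y. q y x = 0"
    have "fst x = 0" by (rule nondegenerate_left) (use *[of "(_, 0)"] in \<open>simp add: q_def\<close>)
    moreover have "snd x = 0" using *[of "(0, 1)"] by (simp add: q_def pairing_simps)
    ultimately show "x = 0" by (simp add: prod_eq_iff)
  qed
  have "\<exists>y. (\<forall>i\<in>I. 0 \<le> q y (m i, 1)) \<and> q y (0, 1) < 0"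
  proof (rule ccontr)
    assume "\<not> ?thesis"
    then have "0 \<le> q y (0, 1)" if "\<And>i. i \<in> I \<Longrightarrow> 0 \<le> q y (m i, 1)" for y
      using that by (meson not_le)
    then obtain c where c: "\<And>i. i \<in> I \<Longrightarrow> 0 \<le> c i"
      "(0, 1) = (\<Sum>i\<in>I. c i *\<^sub>R (m i, 1::real))"
      using lifted.Farkas[of I "\<lambda>i. (m i, 1)" "(0, 1)"] \<open>finite I\<close> by blast
    have "(\<Sum>i\<in>I. c i *\<^sub>R m i) = 0" "(\<Sum>i\<in>I. c i) = 1"
      using arg_cong[OF c(2), of fst] arg_cong[OF c(2), of snd]
      by (simp_all add: fst_sum snd_sum)
    moreover from this obtain j where "j \<in> I" "c j \<noteq> 0"
      by (metis sum.neutral zero_neq_one)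
    ultimately show False
      using no_relation[of c j] c(1) by (metis order_le_less)
  qed
  then obtain y where y: "\<And>i. i \<in> I \<Longrightarrow> 0 \<le> q y (m i, 1)" "q y (0, 1) < 0" by blast
  have "0 < p (m i) (fst y)" if "i \<in> I" for i
    using y(1)[OF that] y(2) by (simp add: q_def pairing_simps)
  then show ?thesis using that by blast
qed

end


section \<open>From real to integral solutions\<close>

lemma simultaneous_approximation:
  fixes a :: "'i \<Rightarrow> real"
  assumes "finite I" "0 < \<epsilon>"
  obtains q :: nat and k :: "'i \<Rightarrow> int"
  where "0 < q" "\<And>i. i \<in> I \<Longrightarrow> \<bar>real q * a i - of_int (k i)\<bar> < \<epsilon>"
proof -
  obtain h where h: "bij_betw h I {0..<card I}"
    using ex_bij_betw_finite_nat[OF \<open>finite I\<close>] by blast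
  obtain D :: nat where D: "D > 0" "1 / D < \<epsilon>"
    using \<open>0 < \<epsilon>\<close> by (metis nat_approx_posE zero_less_Suc)
  obtain q l where q: "0 < q"
    and l: "\<And>i. i < card I \<Longrightarrow> \<bar>of_int q * a (the_inv_into I h i) - of_int (l i)\<bar> < 1 / D"
    using Dirichlet_approx_simult[OF D(1), of "card I" "\<lambda>i. a (the_inv_into I h i)"] by metis
  show ?thesis
  proof
    show "0 < nat q" using q by simp
    fix i assume "i \<in> I"
    then have "h i < card I" "the_inv_into I h (h i) = i"
      using h by (auto simp: bij_betw_def the_inv_into_f_f)
    then show "\<bar>real (nat q) * a i - of_int (l (h i))\<bar> < \<epsilon>"
      using l[of "h i"] D(2) q by simp
  qed
qed

lemma eq_0_if_small_Ints:
  fixes x :: real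
  assumes "x \<in> \<int>" "\<bar>x\<bar> < 1"
  shows "x = 0"
  using assms by (auto elim!: Ints_cases simp flip: of_int_abs)

locale dual_bases =
  fixes n :: nat
    and p :: "'w::real_vector \<Rightarrow> 'v::real_vector \<Rightarrow> real"
    and M :: "'w set" and N :: "'v set"
    and e :: "nat \<Rightarrow> 'w" and f :: "nat \<Rightarrow> 'v"
  assumes bilinear: "bilinear p"
    and M_eq: "M = {\<Sum>i<n. of_int (k i) *\<^sub>R e i | k :: nat \<Rightarrow> int. True}"
    and N_eq: "N = {\<Sum>i<n. of_int (k i) *\<^sub>R f i | k :: nat \<Rightarrow> int. True}"
    and span_M: "span M = UNIV" and span_N: "span N = UNIV"
    and dual: "i < n \<Longrightarrow> j < n \<Longrightarrow> p (e i) (f j) = (if i = j then 1 else 0)"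
begin

lemma coordinates_left: "u = (\<Sum>i<n. p u (f i) *\<^sub>R e i)"
proof -
  note l = bilinear_ladd[OF bilinear] bilinear_lmul[OF bilinear]
  have "u \<in> span M" using span_M by simp
  then show ?thesis
  proof (induction u rule: span_induct_alt)
    case base
    then show ?case by (simp add: bilinear_lzero[OF bilinear])
  next
    case (step c x y)
    then obtain k where x: "x = (\<Sum>i<n. of_int (k i) *\<^sub>R e i)" unfolding M_eq by blast
    have lin: "linear (\<lambda>x. p x (f j))" for j using bilinear by (auto simp: bilinear_def)
    have "p x (f j) = of_int (k j)" if "j < n" for j
      using that by (simp add: x linear_sum[OF lin] l dual if_distrib cong: if_cong)
    then have "(\<Sum>i<n. p x (f i) *\<^sub>R e i) = x" by (simp add: x)
    then show ?case
      using step.IH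
      by (simp add: l scaleR_add_left sum.distrib flip: scaleR_scaleR scaleR_sum_right)
  qed
qed

lemma coordinates_right: "v = (\<Sum>i<n. p (e i) v *\<^sub>R f i)"
proof -
  note l = bilinear_radd[OF bilinear] bilinear_rmul[OF bilinear]
  have "v \<in> span N" using span_N by simp
  then show ?thesis
  proof (induction v rule: span_induct_alt)
    case base
    then show ?case by (simp add: bilinear_rzero[OF bilinear])
  next
    case (step c x y)
    then obtain k where x: "x = (\<Sum>i<n. of_int (k i) *\<^sub>R f i)" unfolding N_eq by blast
    have lin: "linear (p (e j))" for j using bilinear by (auto simp: bilinear_def)
    have "p (e j) x = of_int (k j)" if "j < n" for j
      using that by (simp add: x linear_sum[OF lin] l dual if_distrib cong: if_cong)
    then have "(\<Sum>i<n. p (e i) x *\<^sub>R f i) = x" by (simp add: x)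
    then show ?case
      using step.IH
      by (simp add: l scaleR_add_left sum.distrib flip: scaleR_scaleR scaleR_sum_right)
  qed
qed

sublocale nondegenerate_pairing p
proof
  show "bilinear p" by (rule bilinear)
  show "x = 0" if "\<And>y. p x y = 0" for x
    using coordinates_left[of x] that by simp
  show "y = 0" if "\<And>x. p x y = 0" for y
    using coordinates_right[of y] that by simp
qed

lemma combination_in_M: "(\<Sum>i<n. of_int (k i) *\<^sub>R e i) \<in> M"
  unfolding M_eq by blast

lemma zero_in_M: "0 \<in> M"
  using combination_in_M[of "\<lambda>_. 0"] by simp

lemma M_add: "a \<in> M \<Longrightarrow> b \<in> M \<Longrightarrow> a + b \<in> M"
proof -
  assume "a \<in> M" "b \<in> M"
  then obtain k l where "a = (\<Sum>i<n. of_int (k i) *\<^sub>R e i)" "b = (\<Sum>i<n. of_int (l i) *\<^sub>R e i)"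
    unfolding M_eq by blast
  then have "a + b = (\<Sum>i<n. of_int (k i + l i) *\<^sub>R e i)"
    by (simp add: scaleR_add_left sum.distrib)
  then show ?thesis by (simp only: combination_in_M)
qed

lemma M_uminus: "a \<in> M \<Longrightarrow> - a \<in> M"
proof -
  assume "a \<in> M"
  then obtain k where "a = (\<Sum>i<n. of_int (k i) *\<^sub>R e i)" unfolding M_eq by blast
  then have "- a = (\<Sum>i<n. of_int (- k i) *\<^sub>R e i)" by (simp add: sum_negf)
  then show ?thesis by (simp only: combination_in_M)
qed

lemma M_sum: "(\<And>i. i \<in> I \<Longrightarrow> a i \<in> M) \<Longrightarrow> (\<Sum>i\<in>I. a i) \<in> M"
  by (induction I rule: infinite_finite_induct) (auto simp: zero_in_M M_add)

lemma M_multiple: "a \<in> M \<Longrightarrow> real k *\<^sub>R a \<in> M"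
  by (induction k) (auto simp: zero_in_M M_add scaleR_add_left)

lemma pairing_Ints:
  assumes "m \<in> M" "g \<in> N"
  shows "p m g \<in> \<int>"
proof -
  obtain k l where "m = (\<Sum>i<n. of_int (k i) *\<^sub>R e i)" "g = (\<Sum>i<n. of_int (l i) *\<^sub>R f i)"
    using assms unfolding M_eq N_eq by blast
  then show ?thesis
    by (auto simp: pairing_simps dual intro!: Ints_sum Ints_mult)
qed

lemma f_in_N: "j < n \<Longrightarrow> f j \<in> N"
  unfolding N_eq
  by (rule CollectI, rule exI[of _ "\<lambda>i. if i = j then 1 else 0"])
     (simp add: if_distrib if_distribR cong: if_cong)

text \<open>Approximate the coordinates of a multiple \<open>q *\<^sub>R u\<close> by integers. The value of the resulting
  lattice point at a \<open>g \<in> G\<close> is an integer close to \<open>0\<close>, hence \<open>0\<close>; at the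
  finitely many \<open>h \<in> H\<close> it stays positive.\<close>

lemma lattice_point_with_same_signs:
  assumes "finite G" "G \<subseteq> N" "finite H"
    and G: "\<And>g. g \<in> G \<Longrightarrow> p u g = 0" and H: "\<And>h. h \<in> H \<Longrightarrow> 0 < p u h"
  obtains m where "m \<in> M" "\<And>g. g \<in> G \<Longrightarrow> p m g = 0" "\<And>h. h \<in> H \<Longrightarrow> 0 < p m h"
proof -
  define C where "C x = (\<Sum>i<n. \<bar>p (e i) x\<bar>)" for x
  have C: "0 \<le> C x" for x by (simp add: C_def sum_nonneg)
  \<comment> \<open>Rounding changes the value at \<open>x\<close> by less than \<open>\<epsilon> (1 + C x)\<close>: this must be at most \<open>1\<close> on \<open>G\<close>
    and at most \<open>p u h\<close> on \<open>H\<close>.\<close>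
  define \<epsilon> where "\<epsilon> = Min (insert 1 ((\<lambda>g. 1 / (1 + C g)) ` G \<union> (\<lambda>h. p u h / (1 + C h)) ` H))"
  have fin: "finite (insert 1 ((\<lambda>g. 1 / (1 + C g)) ` G \<union> (\<lambda>h. p u h / (1 + C h)) ` H))"
    using assms by simp
  have C1: "0 < 1 + C x" for x using C[of x] by simp
  have "0 < \<epsilon>"
    unfolding \<epsilon>_def using fin H C1 by (auto simp: divide_pos_pos)
  have G_le: "\<epsilon> \<le> 1 / (1 + C g)" if "g \<in> G" for g
    unfolding \<epsilon>_def by (rule Min_le[OF fin]) (use that in auto)
  have \<epsilon>G: "\<epsilon> * (1 + C g) \<le> 1" if "g \<in> G" for g
    using G_le[OF that] C1[of g] by (simp add: pos_le_divide_eq)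
  have H_le: "\<epsilon> \<le> p u h / (1 + C h)" if "h \<in> H" for h
    unfolding \<epsilon>_def by (rule Min_le[OF fin]) (use that in auto)
  have \<epsilon>H: "\<epsilon> * (1 + C h) \<le> p u h" if "h \<in> H" for h
    using H_le[OF that] C1[of h] by (simp add: pos_le_divide_eq)
  obtain q k where q: "0 < q"
    and k: "\<And>i. i \<in> {..<n} \<Longrightarrow> \<bar>real q * p u (f i) - of_int (k i)\<bar> < \<epsilon>"
    using simultaneous_approximation[OF finite_lessThan \<open>0 < \<epsilon>\<close>, of n "\<lambda>i. p u (f i)"] by metis
  define m where "m = (\<Sum>i<n. of_int (k i) *\<^sub>R e i)"
  have diff: "\<bar>p m x - real q * p u x\<bar> < \<epsilon> * (1 + C x)" for x
  proof -
    have "p u x = (\<Sum>i<n. p u (f i) * p (e i) x)"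
      using arg_cong[OF coordinates_left[of u], of "\<lambda>u. p u x"]
      by (simp only: pairing_simps real_scaleR_def)
    then have "p m x - real q * p u x = (\<Sum>i<n. (of_int (k i) - real q * p u (f i)) * p (e i) x)"
      by (simp add: m_def pairing_simps sum_distrib_left sum_subtractf left_diff_distrib mult.assoc)
    also have "\<bar>\<dots>\<bar> \<le> (\<Sum>i<n. \<epsilon> * \<bar>p (e i) x\<bar>)"
      using k[THEN less_imp_le] by (intro order_trans[OF sum_abs] sum_mono)
        (auto simp: abs_mult abs_minus_commute intro!: mult_right_mono)
    also have "\<dots> = \<epsilon> * C x" by (simp add: C_def sum_distrib_left)
    also have "\<dots> < \<epsilon> * (1 + C x)" using \<open>0 < \<epsilon>\<close> by (simp add: algebra_simps)
    finally show ?thesis .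
  qed
  show ?thesis
  proof
    show "m \<in> M" unfolding m_def by (rule combination_in_M)
    show "p m g = 0" if "g \<in> G" for g
    proof (rule eq_0_if_small_Ints)
      show "p m g \<in> \<int>" using pairing_Ints \<open>m \<in> M\<close> that assms by blast
      show "\<bar>p m g\<bar> < 1" using diff[of g] G[OF that] \<epsilon>G[OF that] by simp
    qed
    show "0 < p m h" if "h \<in> H" for h
    proof -
      have "1 * p u h \<le> real q * p u h"
        by (rule mult_right_mono) (use q H[OF that] in auto)
      then show ?thesis using diff[of h] \<epsilon>H[OF that] by linarith
    qed
  qed
qed

text \<open>Dirichlet's theorem again: for suitable \<open>q\<close> the coefficients \<open>q * c i\<close> are so close to integers
  that rounding them changes \<open>\<Sum>i\<in>I. c i *\<^sub>R m i = 0\<close> by a lattice vector whose integral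
  coordinates are all less than \<open>1\<close>.\<close>

lemma integral_relation:
  assumes "finite I" "\<And>i. i \<in> I \<Longrightarrow> m i \<in> M" "\<And>i. i \<in> I \<Longrightarrow> 0 \<le> c i"
    and "(\<Sum>i\<in>I. c i *\<^sub>R m i) = 0" "j \<in> I" "0 < c j"
  obtains k :: "'i \<Rightarrow> nat" where "(\<Sum>i\<in>I. real (k i) *\<^sub>R m i) = 0" "0 < k j"
proof -
  define C where "C l = (\<Sum>i\<in>I. \<bar>p (m i) (f l)\<bar>)" for l
  have C: "0 \<le> C x" for x by (simp add: C_def sum_nonneg)
  have C1: "0 < 1 + C x" for x using C[of x] by simp
  \<comment> \<open>The bound \<open>1\<close> keeps the rounded coefficients nonnegative, and \<open>c j\<close> keeps the \<open>j\<close>-th one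
    positive.\<close>
  define \<epsilon> where "\<epsilon> = Min (insert 1 (insert (c j) ((\<lambda>l. 1 / (1 + C l)) ` {..<n})))"
  have fin: "finite (insert 1 (insert (c j) ((\<lambda>l. 1 / (1 + C l)) ` {..<n})))" by simp
  have "0 < \<epsilon>" unfolding \<epsilon>_def using fin C1 \<open>0 < c j\<close> by (auto simp: divide_pos_pos)
  have "\<epsilon> \<le> 1" "\<epsilon> \<le> c j" unfolding \<epsilon>_def by (rule Min_le[OF fin], simp)+
  have C_le: "\<epsilon> \<le> 1 / (1 + C l)" if "l < n" for l
    unfolding \<epsilon>_def by (rule Min_le[OF fin]) (use that in auto)
  have \<epsilon>C: "\<epsilon> * (1 + C l) \<le> 1" if "l < n" for l
    using C_le[OF that] C1[of l] by (simp add: pos_le_divide_eq)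
  obtain q k where q: "0 < q" and k: "\<And>i. i \<in> I \<Longrightarrow> \<bar>real q * c i - of_int (k i)\<bar> < \<epsilon>"
    using simultaneous_approximation[OF \<open>finite I\<close> \<open>0 < \<epsilon>\<close>, of c] by metis
  have nonneg: "0 \<le> k i" if "i \<in> I" for i
  proof -
    have "0 \<le> real q * c i" using assms(3)[OF that] by simp
    then have "(-1::real) < of_int (k i)" using k[OF that] \<open>\<epsilon> \<le> 1\<close> by linarith
    then show ?thesis by linarith
  qed
  have "1 * c j \<le> real q * c j" by (rule mult_right_mono) (use q \<open>0 < c j\<close> in auto)
  then have "(0::real) < of_int (k j)" using k[OF \<open>j \<in> I\<close>] \<open>\<epsilon> \<le> c j\<close> by linarith
  then have pos: "0 < nat (k j)" by simp
  define x where "x = (\<Sum>i\<in>I. real (nat (k i)) *\<^sub>R m i)"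
  have "x \<in> M" unfolding x_def using assms(2) by (intro M_sum M_multiple)
  have "p x (f l) = 0" if l: "l < n" for l
  proof (rule eq_0_if_small_Ints)
    show "p x (f l) \<in> \<int>" using pairing_Ints \<open>x \<in> M\<close> f_in_N[OF l] by blast
    have "(\<Sum>i\<in>I. c i * p (m i) (f l)) = p (\<Sum>i\<in>I. c i *\<^sub>R m i) (f l)"
      by (simp add: pairing_simps)
    then have "(\<Sum>i\<in>I. c i * p (m i) (f l)) = 0" using assms(4) by (simp add: pairing_simps)
    then have "p x (f l) = p x (f l) - real q * (\<Sum>i\<in>I. c i * p (m i) (f l))" by simp
    also have "\<dots> = (\<Sum>i\<in>I. (of_int (k i) - real q * c i) * p (m i) (f l))"
      using nonneg by (simp add: x_def pairing_simps sum_distrib_left sum_subtractf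
          left_diff_distrib mult.assoc)
    also have "\<bar>\<dots>\<bar> \<le> (\<Sum>i\<in>I. \<epsilon> * \<bar>p (m i) (f l)\<bar>)"
      using k[THEN less_imp_le] by (intro order_trans[OF sum_abs] sum_mono)
        (auto simp: abs_mult abs_minus_commute intro!: mult_right_mono)
    also have "\<dots> = \<epsilon> * C l" by (simp add: C_def sum_distrib_left)
    also have "\<dots> < \<epsilon> * (1 + C l)" using \<open>0 < \<epsilon>\<close> by (simp add: algebra_simps)
    also have "\<dots> \<le> 1" by (rule \<epsilon>C[OF l])
    finally show "\<bar>p x (f l)\<bar> < 1" .
  qed
  then have "x = 0" using coordinates_left[of x] by simp
  then show ?thesis using that[of "\<lambda>i. nat (k i)"] pos by (simp add: x_def)
qed

end


section \<open>Prime congruences over the tropical semifield\<close>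

lemma subsemiringD:
  assumes "subsemiring S"
  shows "0 \<in> S" "1 \<in> S" "a \<in> S \<Longrightarrow> b \<in> S \<Longrightarrow> a + b \<in> S" "a \<in> S \<Longrightarrow> b \<in> S \<Longrightarrow> a * b \<in> S"
  using assms by (auto simp: subsemiring_def)

lemma subsemiring_power: "subsemiring S \<Longrightarrow> a \<in> S \<Longrightarrow> a ^ k \<in> S"
  by (induction k) (auto simp: subsemiringD)

lemma congruence_trans: "congruence S C \<Longrightarrow> (a, b) \<in> C \<Longrightarrow> (b, c) \<in> C \<Longrightarrow> (a, c) \<in> C"
  unfolding congruence_def equiv_def by (blast dest: transD)

lemma CSpecT_iff:
  assumes S: "subsemiring S" and \<iota>: "\<And>r. \<iota> r \<in> S"
  shows "P \<in> CSpecT \<iota> S \<longleftrightarrow>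
    congruence S P \<and> (\<forall>r s. (\<iota> r, \<iota> s) \<in> P \<longrightarrow> r = s) \<and>
    (\<forall>a\<in>S. \<forall>b\<in>S. \<forall>c\<in>S. \<forall>d\<in>S.
      (a * c + b * d, a * d + b * c) \<in> P \<longrightarrow> (a, b) \<in> P \<or> (c, d) \<in> P)"
proof -
  have "P `` {\<iota> r} = P `` {\<iota> s} \<longleftrightarrow> (\<iota> r, \<iota> s) \<in> P" if "congruence S P" for r s
    using eq_equiv_class_iff[of S P "\<iota> r" "\<iota> s"] that \<iota> by (simp add: congruence_def)
  then have inj: "inj (\<lambda>r. P `` {\<iota> r}) \<longleftrightarrow> (\<forall>r s. (\<iota> r, \<iota> s) \<in> P \<longrightarrow> r = s)"
    if "congruence S P"
    using that by (simp add: inj_def)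
  have proper: "S \<times> S - P \<noteq> {}" if "\<forall>r s. (\<iota> r, \<iota> s) \<in> P \<longrightarrow> r = s"
  proof -
    have "(\<iota> 0, \<iota> 1) \<in> S \<times> S - P" using that[rule_format, of 0 1] \<iota> by auto
    then show ?thesis by blast
  qed
  have prime: "(\<forall>x\<in>S \<times> S - P. \<forall>y\<in>S \<times> S - P. twisted_product x y \<in> S \<times> S - P) \<longleftrightarrow>
    (\<forall>a\<in>S. \<forall>b\<in>S. \<forall>c\<in>S. \<forall>d\<in>S.
      (a * c + b * d, a * d + b * c) \<in> P \<longrightarrow> (a, b) \<in> P \<or> (c, d) \<in> P)"
    (is "?L \<longleftrightarrow> ?R")
  proof
    assume L: ?L
    show ?R
    proof (intro ballI impI, rule ccontr)
      fix a b c d assume "a \<in> S" "b \<in> S" "c \<in> S" "d \<in> S"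
        and "(a * c + b * d, a * d + b * c) \<in> P" and "\<not> ((a, b) \<in> P \<or> (c, d) \<in> P)"
      then show False using L[rule_format, of "(a, b)" "(c, d)"] by (simp add: twisted_product_def)
    qed
  next
    assume R: ?R
    show ?L
    proof (intro ballI)
      fix x y assume "x \<in> S \<times> S - P" "y \<in> S \<times> S - P"
      then show "twisted_product x y \<in> S \<times> S - P"
        using R[rule_format, of "fst x" "snd x" "fst y" "snd y"] subsemiringD[OF S]
        by (auto simp: twisted_product_def)
    qed
  qed
  show ?thesis
    unfolding CSpecT_def CSpec_def prime_congruence_def prime mem_Collect_eq
    using inj proper by argo
qed

locale tropical_algebra =
  fixes S :: "'a::comm_semiring_1 set" and \<iota> :: "trop \<Rightarrow> 'a"
  assumes subsemiring: "subsemiring S"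
    and idem: "a + a = (a::'a)"
    and \<iota>_mem: "\<iota> r \<in> S"
    and \<iota>_0: "\<iota> 0 = 0" and \<iota>_1: "\<iota> 1 = 1"
    and \<iota>_add: "\<iota> (r + s) = \<iota> r + \<iota> s" and \<iota>_mult: "\<iota> (r * s) = \<iota> r * \<iota> s"
begin

lemmas closed = subsemiringD[OF subsemiring]

lemma CSpecT_I:
  assumes "congruence S P" "\<And>r s. (\<iota> r, \<iota> s) \<in> P \<Longrightarrow> r = s"
    and "\<And>a b c d. a \<in> S \<Longrightarrow> b \<in> S \<Longrightarrow> c \<in> S \<Longrightarrow> d \<in> S \<Longrightarrow>
      (a * c + b * d, a * d + b * c) \<in> P \<Longrightarrow> (a, b) \<in> P \<or> (c, d) \<in> P"
  shows "P \<in> CSpecT \<iota> S"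
  unfolding CSpecT_iff[OF subsemiring \<iota>_mem]
  by (intro conjI allI ballI impI) (rule assms; assumption)+

lemma
  assumes "P \<in> CSpecT \<iota> S"
  shows CSpecT_congruence: "congruence S P"
    and CSpecT_inj: "(\<iota> r, \<iota> s) \<in> P \<Longrightarrow> r = s"
    and CSpecT_prime: "a \<in> S \<Longrightarrow> b \<in> S \<Longrightarrow> c \<in> S \<Longrightarrow> d \<in> S \<Longrightarrow>
      (a * c + b * d, a * d + b * c) \<in> P \<Longrightarrow> (a, b) \<in> P \<or> (c, d) \<in> P"
  using assms[unfolded CSpecT_iff[OF subsemiring \<iota>_mem]] by simp_all

lemma CSpecT_restrict:
  assumes S': "subsemiring S'" "S \<subseteq> S'" and P: "P \<in> CSpecT \<iota> S'"
  shows "P \<inter> S \<times> S \<in> CSpecT \<iota> S"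
proof -
  interpret S': tropical_algebra S' \<iota>
    by standard (use S' idem \<iota>_mem \<iota>_0 \<iota>_1 \<iota>_add \<iota>_mult in auto)
  note c = S'.CSpecT_congruence[OF P]
  show ?thesis
  proof (rule CSpecT_I)
    show "congruence S (P \<inter> S \<times> S)"
      unfolding congruence_def equiv_def
    proof (intro conjI allI impI)
      show "refl_on S (P \<inter> S \<times> S)"
        using congruence_refl[OF c] S' by (auto simp: refl_on_def)
      then show "(0, 0) \<in> P \<inter> S \<times> S" "(1, 1) \<in> P \<inter> S \<times> S"
        using closed by (auto simp: refl_on_def)
      show "sym (P \<inter> S \<times> S)" using congruence_sym[OF c] by (auto simp: sym_def)
      show "trans (P \<inter> S \<times> S)" using congruence_trans[OF c] by (auto intro!: transI)
    qed (auto intro: congruence_add[OF c] congruence_mult[OF c] closed)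
    show "r = s" if "(\<iota> r, \<iota> s) \<in> P \<inter> S \<times> S" for r s
      using that S'.CSpecT_inj[OF P] by blast
    show "(a, b) \<in> P \<inter> S \<times> S \<or> (c, d) \<in> P \<inter> S \<times> S"
      if "a \<in> S" "b \<in> S" "c \<in> S" "d \<in> S"
        "(a * c + b * d, a * d + b * c) \<in> P \<inter> S \<times> S" for a b c d
      using that S'.CSpecT_prime[OF P, of a b c d] S'(2) by blast
  qed
qed

text \<open>In an ordered domain such as \<open>\<T>\<close> the twisted product of two pairs of distinct elements
  is again such a pair; the hypothesis \<open>dichotomy\<close> transports this through the filter.\<close>

lemma eventually_equal_in_CSpecT:
  fixes E :: "'t \<Rightarrow> 'a \<Rightarrow> trop"
  assumes "F \<noteq> bot"
    and add: "\<And>t a b. a \<in> S \<Longrightarrow> b \<in> S \<Longrightarrow> E t (a + b) = E t a + E t b"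
    and mult: "\<And>t a b. a \<in> S \<Longrightarrow> b \<in> S \<Longrightarrow> E t (a * b) = E t a * E t b"
    and const: "\<And>t r. E t (\<iota> r) = r"
    and dichotomy: "\<And>a b. a \<in> S \<Longrightarrow> b \<in> S \<Longrightarrow>
      (\<forall>\<^sub>F t in F. E t a = E t b) \<or> (\<forall>\<^sub>F t in F. E t a \<noteq> E t b)"
  shows "{(a, b). a \<in> S \<and> b \<in> S \<and> (\<forall>\<^sub>F t in F. E t a = E t b)} \<in> CSpecT \<iota> S" (is "?P \<in> _")
proof -
  have trop: "a * c + b * d \<noteq> a * d + b * c" if "a \<noteq> b" "c \<noteq> d" for a b c d :: trop
    using that by (cases a; cases b; cases c; cases d) auto
  show ?thesis
  proof (rule CSpecT_I)
    show "congruence S ?P"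
      unfolding congruence_def equiv_def
    proof (intro conjI allI impI)
      show "trans ?P" by (rule transI) (auto elim: eventually_elim2)
      show "sym ?P" by (rule symI) (auto elim: eventually_mono)
      fix a b c d assume "(a, b) \<in> ?P" "(c, d) \<in> ?P"
      then show "(a + c, b + d) \<in> ?P" "(a * c, b * d) \<in> ?P"
        by (auto simp: closed add mult elim: eventually_elim2)
    qed (auto simp: refl_on_def closed)
    show "r = s" if "(\<iota> r, \<iota> s) \<in> ?P" for r s
      using that \<open>F \<noteq> bot\<close> by (simp add: const)
    show "(a, b) \<in> ?P \<or> (c, d) \<in> ?P"
      if mem: "a \<in> S" "b \<in> S" "c \<in> S" "d \<in> S"
        and eq: "(a * c + b * d, a * d + b * c) \<in> ?P" for a b c d
    proof (rule ccontr)
      assume "\<not> ?thesis"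
      then have ne: "\<forall>\<^sub>F t in F. E t a \<noteq> E t b" "\<forall>\<^sub>F t in F. E t c \<noteq> E t d"
        using dichotomy mem by auto
      have "\<forall>\<^sub>F t in F. E t (a * c + b * d) = E t (a * d + b * c)" using eq by simp
      with ne have "\<forall>\<^sub>F t in F. False"
        by eventually_elim (use mem trop in \<open>simp add: add mult closed\<close>)
      then show False using \<open>F \<noteq> bot\<close> by (simp add: eventually_False)
    qed
  qed
qed

end

locale tropical_prime = tropical_algebra S \<iota>
  for S :: "'a::comm_semiring_1 set" and \<iota> +
  fixes P :: "('a \<times> 'a) set"
  assumes point: "P \<in> CSpecT \<iota> S"
begin

lemmas congr = CSpecT_congruence[OF point]
lemmas const_inj = CSpecT_inj[OF point]
lemmas prime = CSpecT_prime[OF point]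

lemma mem: "(a, b) \<in> P \<Longrightarrow> a \<in> S \<and> b \<in> S"
  using congr by (auto simp: congruence_def)

lemmas P_refl = congruence_refl[OF congr]
lemmas P_sym = congruence_sym[OF congr]
lemmas P_trans = congruence_trans[OF congr]
lemmas P_add = congruence_add[OF congr]
lemmas P_mult = congruence_mult[OF congr]

lemma cancel:
  assumes "c \<in> S" "(c, 0) \<notin> P" "a \<in> S" "b \<in> S" "(c * a, c * b) \<in> P"
  shows "(a, b) \<in> P"
  using prime[of c 0 a b] assms closed by simp

lemma power_nonzero: "c \<in> S \<Longrightarrow> (c, 0) \<notin> P \<Longrightarrow> (c ^ k, 0) \<notin> P"
proof (induction k)
  case 0
  show ?case using const_inj[of 1 0] by (auto simp: \<iota>_0 \<iota>_1)
next
  case (Suc k)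
  then show ?case
    using cancel[of c "c ^ k" 0] closed subsemiring_power[OF subsemiring] by auto
qed

text \<open>Some power of \<open>X\<close> carries any two elements of \<open>S'\<close> into \<open>S\<close>, where they can be compared
  modulo \<open>P\<close>. Since \<open>X\<close> can be cancelled, the outcome is the same for all such powers; hence
  primality is inherited, and nothing new is identified in \<open>S\<close>.\<close>

lemma localisation:
  assumes S': "subsemiring S'" "S \<subseteq> S'"
    and X: "X \<in> S" "(X, 0) \<notin> P" and reach: "\<And>f. f \<in> S' \<Longrightarrow> \<exists>k. X ^ k * f \<in> S"
  defines "Q \<equiv> {(f, g). f \<in> S' \<and> g \<in> S' \<and> (\<exists>k. (X ^ k * f, X ^ k * g) \<in> P)}"
  shows "Q \<in> CSpecT \<iota> S'" "Q \<inter> S \<times> S = P"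
proof -
  interpret S': tropical_algebra S' \<iota>
    by standard (use S' idem \<iota>_mem \<iota>_0 \<iota>_1 \<iota>_add \<iota>_mult in auto)
  have Xk: "X ^ k \<in> S" "(X ^ k, 0) \<notin> P" for k
    using X power_nonzero subsemiring_power[OF subsemiring] by blast+
  have up: "(X ^ (l + k) * f, X ^ (l + k) * g) \<in> P" if "(X ^ k * f, X ^ k * g) \<in> P" for f g k l
    using P_mult[OF P_refl[OF Xk(1)] that, of l] by (simp add: power_add mult.assoc)
  have down: "(X ^ k * f, X ^ k * g) \<in> P"
    if "(f, g) \<in> Q" "X ^ k * f \<in> S" "X ^ k * g \<in> S" for f g k
  proof -
    obtain l where "(X ^ l * f, X ^ l * g) \<in> P" using \<open>(f, g) \<in> Q\<close> by (auto simp: Q_def)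
    from up[OF this, of k] have "(X ^ l * (X ^ k * f), X ^ l * (X ^ k * g)) \<in> P"
      by (simp add: power_add ac_simps)
    then show ?thesis using cancel Xk that by blast
  qed
  have reach2: "\<exists>k. X ^ k * f \<in> S \<and> X ^ k * g \<in> S" if fg: "f \<in> S'" "g \<in> S'" for f g
  proof -
    obtain k l where kl: "X ^ k * f \<in> S" "X ^ l * g \<in> S" using reach fg by blast
    have "X ^ l * (X ^ k * f) \<in> S" "X ^ k * (X ^ l * g) \<in> S" using kl Xk closed by blast+
    then show ?thesis by (intro exI[of _ "k + l"]) (simp add: power_add ac_simps)
  qed
  show QS: "Q \<inter> S \<times> S = P"
  proof
    show "Q \<inter> S \<times> S \<subseteq> P" using down[where k = 0] by auto
    show "P \<subseteq> Q \<inter> S \<times> S" using mem S' by (auto simp: Q_def intro!: exI[of _ 0])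
  qed
  have "congruence S' Q"
    unfolding congruence_def equiv_def
  proof (intro conjI allI impI)
    show "refl_on S' Q"
      using reach P_refl by (auto simp: Q_def refl_on_def)
    then show "(0, 0) \<in> Q" "(1, 1) \<in> Q" using S'.closed by (auto simp: refl_on_def)
    show "sym Q" by (rule symI) (auto simp: Q_def dest: P_sym)
    show "trans Q"
    proof (rule transI)
      fix f g h assume fgh: "(f, g) \<in> Q" "(g, h) \<in> Q"
      then obtain k l where
        "(X ^ k * f, X ^ k * g) \<in> P" "(X ^ l * g, X ^ l * h) \<in> P" by (auto simp: Q_def)
      then have "(X ^ (k + l) * f, X ^ (k + l) * h) \<in> P"
        using up[of k f g l] up[of l g h k] by (metis P_trans add.commute)
      then show "(f, h) \<in> Q" using fgh by (auto simp: Q_def)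
    qed
    fix a b c d assume "(a, b) \<in> Q" "(c, d) \<in> Q"
    then obtain k l where in_S': "a \<in> S'" "b \<in> S'" "c \<in> S'" "d \<in> S'"
      and k: "(X ^ k * a, X ^ k * b) \<in> P" and l: "(X ^ l * c, X ^ l * d) \<in> P"
      by (auto simp: Q_def)
    have "(X ^ (k + l) * (a + c), X ^ (k + l) * (b + d)) \<in> P"
      using P_add[OF up[OF k, of l] up[OF l, of k]]
      by (simp add: add.commute[of l k] distrib_left)
    then show "(a + c, b + d) \<in> Q" using in_S' S'.closed by (auto simp: Q_def)
    have "(X ^ (k + l) * (a * c), X ^ (k + l) * (b * d)) \<in> P"
      using P_mult[OF k l] by (simp add: power_add ac_simps)
    then show "(a * c, b * d) \<in> Q" using in_S' S'.closed by (auto simp: Q_def)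
  qed (auto simp: Q_def)
  then show "Q \<in> CSpecT \<iota> S'"
  proof (rule S'.CSpecT_I)
    show "r = s" if "(\<iota> r, \<iota> s) \<in> Q" for r s
      using that QS \<iota>_mem const_inj by blast
    show "(a, b) \<in> Q \<or> (c, d) \<in> Q"
      if in_S': "a \<in> S'" "b \<in> S'" "c \<in> S'" "d \<in> S'"
        and eq: "(a * c + b * d, a * d + b * c) \<in> Q" for a b c d
    proof -
      obtain k l where kl: "X ^ k * a \<in> S" "X ^ k * b \<in> S" "X ^ l * c \<in> S" "X ^ l * d \<in> S"
        using reach2 in_S' by meson
      have *: "X ^ (k + l) * (a * c + b * d) =
          (X ^ k * a) * (X ^ l * c) + (X ^ k * b) * (X ^ l * d)"
        "X ^ (k + l) * (a * d + b * c) =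
          (X ^ k * a) * (X ^ l * d) + (X ^ k * b) * (X ^ l * c)"
        by (simp_all add: power_add algebra_simps)
      have "X ^ (k + l) * (a * c + b * d) \<in> S" "X ^ (k + l) * (a * d + b * c) \<in> S"
        unfolding * by (intro closed kl)+
      from prime[OF kl, folded *, OF down[OF eq this]] show ?thesis
        using in_S' by (auto simp: Q_def)
    qed
  qed
qed

definition le (infix "\<preceq>" 50) where "a \<preceq> b \<longleftrightarrow> (a + b, b) \<in> P"

lemma le_mem: "a \<preceq> b \<Longrightarrow> b \<in> S"
  using mem by (auto simp: le_def)

lemma le_refl: "a \<in> S \<Longrightarrow> a \<preceq> a"
  by (simp add: le_def idem P_refl)

lemma zero_le: "a \<in> S \<Longrightarrow> 0 \<preceq> a"
  by (simp add: le_def P_refl)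

lemma le_trans:
  assumes "a \<in> S" "a \<preceq> b" "b \<preceq> c"
  shows "a \<preceq> c"
proof -
  have S: "b \<in> S" "c \<in> S" using assms le_mem by auto
  have "(a + c, a + (b + c)) \<in> P"
    using assms S by (intro P_add P_refl P_sym[of "b + c" c]) (auto simp: le_def)
  moreover have "((a + b) + c, b + c) \<in> P"
    using assms S by (intro P_add P_refl) (auto simp: le_def)
  ultimately show ?thesis
    using assms(3) P_trans unfolding le_def by (metis add.assoc)
qed

text \<open>Both components of the twisted product of \<open>(a + b, a)\<close> and \<open>(a + b, b)\<close> are
  \<open>a\<^sup>2 + ab + b\<^sup>2\<close>, because addition is idempotent.\<close>

lemma le_total:
  assumes "a \<in> S" "b \<in> S"
  shows "a \<preceq> b \<or> b \<preceq> a"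
proof -
  have "(a + b) * (a + b) + a * b = a * a + (a * b + a * b) + a * b + b * b"
    by (simp add: algebra_simps)
  then have eq1: "(a + b) * (a + b) + a * b = a * a + a * b + b * b" by (simp add: idem add.assoc)
  have "(a + b) * b + a * (a + b) = a * a + (a * b + a * b) + b * b"
    by (simp add: algebra_simps)
  then have eq2: "(a + b) * b + a * (a + b) = a * a + a * b + b * b" by (simp add: idem)
  have "((a + b) * (a + b) + a * b, (a + b) * b + a * (a + b)) \<in> P"
    unfolding eq1 eq2 using assms closed by (intro P_refl) auto
  then have "(a + b, a) \<in> P \<or> (a + b, b) \<in> P"
    using prime[of "a + b" a "a + b" b] assms closed by blast
  then show ?thesis by (auto simp: le_def add.commute)
qed

lemma le_of_congruent: "(a, b) \<in> P \<Longrightarrow> a \<preceq> b"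
  using P_add[of a b b b] P_refl[of b] mem by (auto simp: le_def idem)

lemma le_mult:
  assumes "a \<in> S" "c \<in> S" "a \<preceq> b" "c \<preceq> d"
  shows "a * c \<preceq> b * d"
proof -
  have S: "b \<in> S" "d \<in> S" using assms le_mem by auto
  have "a * c \<preceq> b * c"
    using P_mult[of "a + b" b c c] assms P_refl by (auto simp: le_def distrib_right)
  moreover have "b * c \<preceq> b * d"
    using P_mult[of b b "c + d" d] assms S P_refl by (auto simp: le_def distrib_left)
  ultimately show ?thesis using le_trans assms closed by blast
qed

lemma add_le:
  assumes "a \<in> S" "a \<preceq> c" "b \<preceq> c"
  shows "a + b \<preceq> c"
proof -
  have "(a + (b + c), a + c) \<in> P"
    using assms by (intro P_add P_refl) (auto simp: le_def)
  then show ?thesis using assms(2) P_trans unfolding le_def by (metis add.assoc)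
qed

lemma const_le_iff: "\<iota> (Fin x) \<preceq> \<iota> (Fin y) \<longleftrightarrow> x \<le> y"
proof
  assume "\<iota> (Fin x) \<preceq> \<iota> (Fin y)"
  then have "Fin x + Fin y = Fin y" by (intro const_inj) (simp only: le_def \<iota>_add)
  then show "x \<le> y" by simp
next
  assume "x \<le> y"
  then have "Fin x + Fin y = Fin y" by simp
  then show "\<iota> (Fin x) \<preceq> \<iota> (Fin y)" by (simp add: le_def P_refl \<iota>_mem del: plus_trop.simps flip: \<iota>_add)
qed

definition upper :: "'a \<Rightarrow> real set" where
  "upper a = {r. a \<preceq> \<iota> (Fin r)}"

text \<open>The infimum of the constants above \<open>a\<close>, meaningful when there are any.\<close>

definition valuation :: "'a \<Rightarrow> trop" where
  "valuation a = (if bdd_below (upper a) then Fin (Inf (upper a)) else NegInf)"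

lemma upper_antimono: "a \<in> S \<Longrightarrow> a \<preceq> b \<Longrightarrow> upper b \<subseteq> upper a"
  using le_trans by (auto simp: upper_def)

lemma valuation_congruent: "(a, b) \<in> P \<Longrightarrow> valuation a = valuation b"
  using upper_antimono[OF _ le_of_congruent, of a b] upper_antimono[OF _ le_of_congruent, of b a]
    P_sym mem unfolding valuation_def by (metis subset_antisym)

lemma valuation_const: "valuation (\<iota> r) = r"
proof (cases r)
  case NegInf
  then have "upper (\<iota> r) = UNIV"
    using zero_le \<iota>_mem by (auto simp: upper_def \<iota>_0[unfolded zero_trop_def])
  moreover have "\<not> bdd_below (UNIV :: real set)"
    unfolding bdd_below_def by (meson UNIV_I lt_ex not_le)
  ultimately show ?thesis by (simp add: valuation_def NegInf)
next
  case (Fin x)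
  then have "upper (\<iota> r) = {x..}" by (auto simp: upper_def const_le_iff)
  then show ?thesis by (simp add: valuation_def Fin)
qed

lemma valuation_add:
  assumes "a \<in> S" "b \<in> S" "upper a \<noteq> {}" "upper b \<noteq> {}"
  shows "valuation (a + b) = valuation a + valuation b"
proof -
  have *: "valuation (a + b) = valuation a + valuation b"
    if "a \<preceq> b" "a \<in> S" "upper b \<noteq> {}" for a b
  proof -
    have "upper b \<subseteq> upper a" using upper_antimono that by blast
    then have "valuation a + valuation b = valuation b"
      using that(3) bdd_below_mono[of "upper a" "upper b"] cInf_superset_mono[of "upper b" "upper a"]
      by (auto simp: valuation_def)
    moreover have "valuation (a + b) = valuation b"
      using valuation_congruent \<open>a \<preceq> b\<close> by (simp add: le_def)
    ultimately show ?thesis by simp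
  qed
  from le_total[OF assms(1,2)] show ?thesis
    using *[of a b] *[of b a] assms by (metis add.commute)
qed

text \<open>That the infimum is not smaller than the sum of the infima needs the order to be total:
  constants that are not above \<open>a\<close> are below \<open>a\<close>.\<close>

lemma valuation_mult:
  assumes S: "a \<in> S" "b \<in> S" and ne: "upper a \<noteq> {}" "upper b \<noteq> {}"
  shows "valuation (a * b) = valuation a * valuation b"
proof -
  have sum: "r + s \<in> upper (a * b)" if "r \<in> upper a" "s \<in> upper b" "a \<in> S" "b \<in> S" for r s a b
    using le_mult[of a b "\<iota> (Fin r)" "\<iota> (Fin s)"] that by (simp add: upper_def flip: \<iota>_mult)
  have unbounded: "valuation (a * b) = NegInf"
    if S: "a \<in> S" "b \<in> S" and "upper b \<noteq> {}" and a: "\<not> bdd_below (upper a)" for a b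
  proof -
    obtain s where s: "s \<in> upper b" using \<open>upper b \<noteq> {}\<close> by blast
    have "\<not> bdd_below (upper (a * b))"
    proof
      assume "bdd_below (upper (a * b))"
      then obtain B where "\<And>t. t \<in> upper (a * b) \<Longrightarrow> B \<le> t" by (auto simp: bdd_below_def)
      then have "B - s \<le> r" if "r \<in> upper a" for r
        using sum[OF that s S] by force
      then show False using a by (auto simp: bdd_below_def)
    qed
    then show ?thesis by (simp add: valuation_def)
  qed
  show ?thesis
  proof (cases "bdd_below (upper a) \<and> bdd_below (upper b)")
    case False
    then show ?thesis
      using unbounded[of a b] unbounded[of b a] assms
      by (auto simp: mult.commute valuation_def split: if_splits)
  next
    case True
    let ?\<alpha> = "Inf (upper a)" and ?\<beta> = "Inf (upper b)"
    have below: "\<iota> (Fin r) \<preceq> c" if "r < Inf (upper c)" "bdd_below (upper c)" "c \<in> S" for r c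
    proof -
      have "r \<notin> upper c" using that cInf_lower by (metis not_le)
      then show ?thesis using le_total[of c "\<iota> (Fin r)"] that \<iota>_mem by (auto simp: upper_def)
    qed
    have lower: "?\<alpha> + ?\<beta> \<le> t" if t: "t \<in> upper (a * b)" for t
    proof (rule field_le_epsilon)
      fix \<epsilon> :: real assume "0 < \<epsilon>"
      then have "\<iota> (Fin (?\<alpha> - \<epsilon> / 2)) \<preceq> a" "\<iota> (Fin (?\<beta> - \<epsilon> / 2)) \<preceq> b"
        using True S by (auto intro!: below)
      then have "\<iota> (Fin ((?\<alpha> - \<epsilon> / 2) + (?\<beta> - \<epsilon> / 2))) \<preceq> a * b"
        using le_mult[of "\<iota> (Fin (?\<alpha> - \<epsilon> / 2))" "\<iota> (Fin (?\<beta> - \<epsilon> / 2))"] \<iota>_mem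
        by (simp flip: \<iota>_mult)
      then have "\<iota> (Fin ((?\<alpha> - \<epsilon> / 2) + (?\<beta> - \<epsilon> / 2))) \<preceq> \<iota> (Fin t)"
        using t le_trans[OF \<iota>_mem] by (auto simp: upper_def)
      then show "?\<alpha> + ?\<beta> \<le> t + \<epsilon>" by (simp add: const_le_iff)
    qed
    then have bdd: "bdd_below (upper (a * b))" by (auto simp: bdd_below_def)
    have le: "Inf (upper (a * b)) \<le> r + s" if "r \<in> upper a" "s \<in> upper b" for r s
      using cInf_lower[OF sum[OF that S] bdd] .
    have "Inf (upper (a * b)) - s \<le> ?\<alpha>" if "s \<in> upper b" for s
      using le that ne by (intro cInf_greatest) (auto simp: algebra_simps)
    then have "Inf (upper (a * b)) - ?\<alpha> \<le> ?\<beta>"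
      using ne by (intro cInf_greatest) (auto simp: algebra_simps)
    moreover have "?\<alpha> + ?\<beta> \<le> Inf (upper (a * b))"
      using lower sum[OF _ _ S] ne by (intro cInf_greatest) blast+
    ultimately show ?thesis using True bdd by (simp add: valuation_def)
  qed
qed

end


section \<open>Tropical polynomials\<close>

lemma trop_idem: "r + r = (r::trop)"
  by (cases r) auto

lemma poly_idem: "F + F = (F :: 'w \<Rightarrow>\<^sub>0 trop)"
  by (rule poly_mapping_eqI) (simp add: lookup_add trop_idem)

abbreviation monomial :: "'w::comm_monoid_add \<Rightarrow> 'w \<Rightarrow>\<^sub>0 trop" where
  "monomial m \<equiv> Poly_Mapping.single m 1"

lemma monomial_mult: "monomial a * monomial b = monomial (a + b)"
  by (simp add: mult_single)

lemma const_times_monomial: "trop_const r * monomial m = Poly_Mapping.single m r"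
  by (simp add: trop_const_def mult_single)

lemma monomial_zero: "monomial 0 = trop_const (Fin 0)"
  by (simp add: trop_const_def one_trop_def)

lemma monoid_semiring_induct [consumes 1, case_names zero single add]:
  assumes "F \<in> monoid_semiring A"
    and zero: "Q 0"
    and single: "\<And>m r. m \<in> A \<Longrightarrow> Q (Poly_Mapping.single m r)"
    and add: "\<And>F G. F \<in> monoid_semiring A \<Longrightarrow> G \<in> monoid_semiring A \<Longrightarrow> Q F \<Longrightarrow> Q G \<Longrightarrow> Q (F + G)"
  shows "Q F"
proof -
  have "F = (\<Sum>m\<in>Poly_Mapping.keys F. Poly_Mapping.single m (Poly_Mapping.lookup F m))"
    by (rule poly_mapping_eqI)
       (simp add: lookup_sum lookup_single when_def in_keys_iff)
  moreover have "(\<Sum>m\<in>K. Poly_Mapping.single m (c m)) \<in> monoid_semiring A \<and>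
      Q (\<Sum>m\<in>K. Poly_Mapping.single m (c m))"
    if "finite K" "K \<subseteq> A" for K and c :: "'a \<Rightarrow> trop"
    using that
  proof (induction K rule: finite_induct)
    case (insert m K)
    have "Poly_Mapping.single m (c m) \<in> monoid_semiring A"
      using insert.prems by (simp add: monoid_semiring_def)
    moreover from this insert have "Poly_Mapping.single m (c m) + (\<Sum>m\<in>K. Poly_Mapping.single m (c m)) \<in> monoid_semiring A"
      using Poly_Mapping.keys_add[of "Poly_Mapping.single m (c m)" "\<Sum>m\<in>K. Poly_Mapping.single m (c m)"]
      by (auto simp: monoid_semiring_def)
    ultimately show ?case using insert by (simp add: single add)
  qed (simp add: zero monoid_semiring_def)
  ultimately show ?thesis
    using assms(1) by (metis finite_keys mem_Collect_eq monoid_semiring_def)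
qed

lemma eval_trop_superset:
  assumes "finite B" "Poly_Mapping.keys F \<subseteq> B"
  shows "eval_trop \<phi> F = (\<Sum>m\<in>B. Poly_Mapping.lookup F m * \<phi> m)"
  unfolding eval_trop_def
  by (rule sum.mono_neutral_left) (use assms in \<open>auto simp: in_keys_iff\<close>)

lemma eval_trop_add: "eval_trop \<phi> (F + G) = eval_trop \<phi> F + eval_trop \<phi> G"
proof -
  let ?B = "Poly_Mapping.keys F \<union> Poly_Mapping.keys G"
  have "Poly_Mapping.keys (F + G) \<subseteq> ?B" by (rule Poly_Mapping.keys_add)
  then show ?thesis
    by (simp add: eval_trop_superset[of ?B] lookup_add distrib_right sum.distrib)
qed

lemma eval_trop_single: "eval_trop \<phi> (Poly_Mapping.single m r) = r * \<phi> m"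
  by (simp add: eval_trop_superset[of "{m}"])

lemma eval_trop_zero: "eval_trop \<phi> 0 = 0"
  by (simp add: eval_trop_def)

lemma eval_trop_mult:
  assumes "\<And>a b. a \<in> A \<Longrightarrow> b \<in> A \<Longrightarrow> \<phi> (a + b) = \<phi> a * \<phi> b"
    and "F \<in> monoid_semiring A" "G \<in> monoid_semiring A"
  shows "eval_trop \<phi> (F * G) = eval_trop \<phi> F * eval_trop \<phi> G"
  using assms(2)
proof (induction F rule: monoid_semiring_induct)
  case (single a r)
  show ?case
    using assms(3)
    by (induction G rule: monoid_semiring_induct)
       (use single assms(1) in \<open>simp_all add: eval_trop_zero mult_single eval_trop_single
         eval_trop_add distrib_left distrib_right ac_simps\<close>)
qed (simp_all add: eval_trop_zero eval_trop_add distrib_right)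

lemma eval_trop_const: "\<phi> 0 = 1 \<Longrightarrow> eval_trop \<phi> (trop_const r) = r"
  by (simp add: trop_const_def eval_trop_single)


section \<open>Cones, faces and their lattice points\<close>

context dual_bases
begin

lemma cone_generators:
  assumes "rational_cone N \<sigma>"
  obtains G where "finite G" "G \<subseteq> N" "G \<subseteq> \<sigma>"
    "\<sigma> = {\<Sum>g\<in>G. c g *\<^sub>R g | c. \<forall>g\<in>G. 0 \<le> c g}"
    "dual_cone p \<sigma> = {u. \<forall>g\<in>G. 0 \<le> p u g}"
proof -
  obtain G where G: "finite G" "G \<subseteq> N" "\<sigma> = {\<Sum>g\<in>G. c g *\<^sub>R g | c. \<forall>g\<in>G. 0 \<le> c g}"
    using assms by (auto simp: rational_cone_def)
  have "G \<subseteq> \<sigma>"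
  proof
    fix g assume g: "g \<in> G"
    have "(\<Sum>h\<in>G. (if h = g then 1 else 0) *\<^sub>R h) = (\<Sum>h\<in>G. if h = g then h else 0)"
      by (rule sum.cong) auto
    also have "\<dots> = g" using G(1) g by simp
    finally show "g \<in> \<sigma>"
      unfolding G(3) by (intro CollectI exI[of _ "\<lambda>h. if h = g then 1 else 0"]) auto
  qed
  moreover have "u \<in> dual_cone p \<sigma> \<longleftrightarrow> (\<forall>g\<in>G. 0 \<le> p u g)" for u
  proof
    assume "u \<in> dual_cone p \<sigma>"
    then show "\<forall>g\<in>G. 0 \<le> p u g" using \<open>G \<subseteq> \<sigma>\<close> by (auto simp: dual_cone_def)
  next
    assume "\<forall>g\<in>G. 0 \<le> p u g"
    then show "u \<in> dual_cone p \<sigma>"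
      by (auto simp: dual_cone_def G(3) pairing_simps intro!: sum_nonneg)
  qed
  ultimately show ?thesis using that[OF G(1,2) _ G(3)] by blast
qed

lemma pairing_combination_eq_0_iff:
  assumes "finite G" "\<And>g. g \<in> G \<Longrightarrow> 0 \<le> c g" "\<And>g. g \<in> G \<Longrightarrow> 0 \<le> p u g"
  shows "p u (\<Sum>g\<in>G. c g *\<^sub>R g) = 0 \<longleftrightarrow> (\<forall>g\<in>G. c g = 0 \<or> p u g = 0)"
  using assms by (simp add: pairing_simps sum_nonneg_eq_0_iff)

lemma cone_monoid_separates:
  assumes "rational_cone N \<sigma>" "v \<notin> \<sigma>"
  obtains m where "m \<in> cone_monoid p M \<sigma>" "p m v < 0"
proof -
  obtain G where G: "finite G" "G \<subseteq> N" "G \<subseteq> \<sigma>"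
    "\<sigma> = {\<Sum>g\<in>G. c g *\<^sub>R g | c. \<forall>g\<in>G. 0 \<le> c g}"
    "dual_cone p \<sigma> = {u. \<forall>g\<in>G. 0 \<le> p u g}"
    by (rule cone_generators[OF assms(1)])
  have "\<exists>u. (\<forall>g\<in>G. 0 \<le> p u g) \<and> p u v < 0"
  proof (rule ccontr)
    assume "\<not> ?thesis"
    then have "0 \<le> p u v" if "\<And>g. g \<in> G \<Longrightarrow> 0 \<le> p u g" for u
      using that by (meson not_le)
    then obtain c where "\<And>g. g \<in> G \<Longrightarrow> 0 \<le> c g" "v = (\<Sum>g\<in>G. c g *\<^sub>R g)"
      using Farkas[of G "\<lambda>g. g" v] G(1) by blast
    then have "v \<in> \<sigma>" unfolding G(4) by blast
    with assms(2) show False ..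
  qed
  then obtain u where u: "\<forall>g\<in>G. 0 \<le> p u g" "p u v < 0" by blast
  obtain m where m: "m \<in> M" "\<And>g. g \<in> {g \<in> G. p u g = 0} \<Longrightarrow> p m g = 0"
    "\<And>h. h \<in> insert (- v) {g \<in> G. 0 < p u g} \<Longrightarrow> 0 < p m h"
  proof (rule lattice_point_with_same_signs[of "{g \<in> G. p u g = 0}" "insert (- v) {g \<in> G. 0 < p u g}" u])
    show "0 < p u h" if "h \<in> insert (- v) {g \<in> G. 0 < p u g}" for h
      using that u(2) by (auto simp: pairing_simps)
  qed (use G in auto)
  have "0 \<le> p m g" if "g \<in> G" for g
    using m(2)[of g] m(3)[of g] u(1) that by (cases "p u g = 0") (auto simp: order.strict_iff_order)
  then have "m \<in> cone_monoid p M \<sigma>" using m(1) by (simp add: cone_monoid_def G(5))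
  moreover have "p m v < 0" using m(3)[of "- v"] by (simp add: pairing_simps)
  ultimately show ?thesis using that by blast
qed

lemma face_lattice_normal:
  assumes "rational_cone N \<sigma>" "cone_face p \<tau> \<sigma>"
  obtains m where "m \<in> cone_monoid p M \<sigma>" "\<tau> = {v \<in> \<sigma>. p m v = 0}"
proof -
  obtain G where G: "finite G" "G \<subseteq> N" "G \<subseteq> \<sigma>"
    "\<sigma> = {\<Sum>g\<in>G. c g *\<^sub>R g | c. \<forall>g\<in>G. 0 \<le> c g}"
    "dual_cone p \<sigma> = {u. \<forall>g\<in>G. 0 \<le> p u g}"
    by (rule cone_generators[OF assms(1)])
  obtain u where u: "\<forall>g\<in>G. 0 \<le> p u g" "\<tau> = {v \<in> \<sigma>. p u v = 0}"
    using assms(2) G(5) by (auto simp: cone_face_def)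
  obtain m where m: "m \<in> M" "\<And>g. g \<in> {g \<in> G. p u g = 0} \<Longrightarrow> p m g = 0"
    "\<And>h. h \<in> {g \<in> G. 0 < p u g} \<Longrightarrow> 0 < p m h"
    by (rule lattice_point_with_same_signs[of "{g \<in> G. p u g = 0}" "{g \<in> G. 0 < p u g}" u])
       (use G in auto)
  have zero: "p m g = 0 \<longleftrightarrow> p u g = 0" and nonneg: "0 \<le> p m g" if "g \<in> G" for g
    using m(2)[of g] m(3)[of g] u(1) that
    by (cases "p u g = 0"; force simp: order.strict_iff_order)+
  have "p u v = 0 \<longleftrightarrow> p m v = 0" if "v \<in> \<sigma>" for v
  proof -
    obtain c where "\<forall>g\<in>G. 0 \<le> c g" "v = (\<Sum>g\<in>G. c g *\<^sub>R g)" using \<open>v \<in> \<sigma>\<close> G(4) by auto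
    then show ?thesis
      using pairing_combination_eq_0_iff[of G c u] pairing_combination_eq_0_iff[of G c m]
        G(1) u(1) zero nonneg by simp
  qed
  then have "\<tau> = {v \<in> \<sigma>. p m v = 0}" using u(2) by blast
  moreover have "m \<in> cone_monoid p M \<sigma>" using m(1) nonneg by (simp add: cone_monoid_def G(5))
  ultimately show ?thesis using that by blast
qed

text \<open>A generator of \<open>\<sigma>\<close> either lies in the face, where \<open>m\<close> is nonnegative, or is a point at which
  \<open>m\<^sub>0\<close> is strictly positive. For the face \<open>\<tau>\<close> with normal vector \<open>m\<^sub>0\<close> this is the equation \<open>M\<^sub>\<tau> = M\<^sub>\<sigma> + \<int> m\<^sub>0\<close>.\<close>

lemma eventually_in_cone_monoid:
  assumes "rational_cone N \<sigma>" "m\<^sub>0 \<in> cone_monoid p M \<sigma>"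
    and "m \<in> cone_monoid p M {v \<in> \<sigma>. p m\<^sub>0 v = 0}"
  shows "\<forall>\<^sub>F k in sequentially. real k *\<^sub>R m\<^sub>0 + m \<in> cone_monoid p M \<sigma>"
proof -
  obtain G where G: "finite G" "G \<subseteq> N" "G \<subseteq> \<sigma>"
    "\<sigma> = {\<Sum>g\<in>G. c g *\<^sub>R g | c. \<forall>g\<in>G. 0 \<le> c g}"
    "dual_cone p \<sigma> = {u. \<forall>g\<in>G. 0 \<le> p u g}"
    by (rule cone_generators[OF assms(1)])
  have m: "m \<in> M" "m\<^sub>0 \<in> M" using assms by (auto simp: cone_monoid_def)
  have "\<forall>\<^sub>F k in sequentially. 0 \<le> p (real k *\<^sub>R m\<^sub>0 + m) g" if g: "g \<in> G" for g
  proof (cases "p m\<^sub>0 g = 0")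
    case True
    then have "0 \<le> p m g" using assms(3) g G(3) by (auto simp: cone_monoid_def dual_cone_def)
    then show ?thesis using True by (simp add: pairing_simps)
  next
    case False
    then have pos: "0 < p m\<^sub>0 g"
      using assms(2) g G(5) by (auto simp: cone_monoid_def order.strict_iff_order)
    have "\<forall>\<^sub>F k in sequentially. - p m g / p m\<^sub>0 g \<le> real k"
      by (rule eventually_ge_at_top[THEN eventually_compose_filterlim, OF filterlim_real_sequentially])
    then show ?thesis
      by eventually_elim (use pos in \<open>simp add: pairing_simps field_simps\<close>)
  qed
  then have "\<forall>\<^sub>F k in sequentially. \<forall>g\<in>G. 0 \<le> p (real k *\<^sub>R m\<^sub>0 + m) g"
    using G(1) by (simp add: eventually_ball_finite)
  then show ?thesis
    by eventually_elim (use m in \<open>simp add: cone_monoid_def G(5) M_add M_multiple\<close>)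
qed

lemma cone_monoid_0: "0 \<in> cone_monoid p M \<sigma>"
  by (simp add: cone_monoid_def dual_cone_def zero_in_M pairing_simps)

lemma cone_monoid_add: "a \<in> cone_monoid p M \<sigma> \<Longrightarrow> b \<in> cone_monoid p M \<sigma> \<Longrightarrow> a + b \<in> cone_monoid p M \<sigma>"
  by (simp add: cone_monoid_def dual_cone_def M_add pairing_simps)

lemma cone_monoid_antimono: "\<tau> \<subseteq> \<sigma> \<Longrightarrow> cone_monoid p M \<sigma> \<subseteq> cone_monoid p M \<tau>"
  by (auto simp: cone_monoid_def dual_cone_def)

abbreviation cone_semiring :: "'v set \<Rightarrow> ('w \<Rightarrow>\<^sub>0 trop) set" where
  "cone_semiring \<sigma> \<equiv> monoid_semiring (cone_monoid p M \<sigma>)"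

lemma cone_semiring_antimono: "\<tau> \<subseteq> \<sigma> \<Longrightarrow> cone_semiring \<sigma> \<subseteq> cone_semiring \<tau>"
  using cone_monoid_antimono[of \<tau> \<sigma>] by (auto simp: monoid_semiring_def)

lemma monomial_mem: "m \<in> cone_monoid p M \<sigma> \<Longrightarrow> monomial m \<in> cone_semiring \<sigma>"
  by (simp add: monoid_semiring_def)

sublocale tropical_algebra "cone_semiring \<sigma>" trop_const for \<sigma>
proof
  show "subsemiring (cone_semiring \<sigma>)"
    using cone_monoid_0 cone_monoid_add by (rule subsemiring_monoid_semiring)
  show "trop_const r \<in> cone_semiring \<sigma>" for r
    using cone_monoid_0 by (auto simp: trop_const_def monoid_semiring_def)
qed (simp_all add: poly_idem trop_const_def single_add mult_single)

lemma monomial_power: "monomial m ^ k = monomial (real k *\<^sub>R (m::'w))"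
  by (induction k) (simp_all add: monomial_mult scaleR_add_left)

lemma eventually_in_cone_semiring:
  assumes "rational_cone N \<sigma>" "m\<^sub>0 \<in> cone_monoid p M \<sigma>"
    and "F \<in> cone_semiring {v \<in> \<sigma>. p m\<^sub>0 v = 0}"
  shows "\<forall>\<^sub>F k in sequentially. monomial m\<^sub>0 ^ k * F \<in> cone_semiring \<sigma>"
proof -
  have "\<forall>\<^sub>F k in sequentially. \<forall>m\<in>Poly_Mapping.keys F. real k *\<^sub>R m\<^sub>0 + m \<in> cone_monoid p M \<sigma>"
    using assms eventually_in_cone_monoid[OF assms(1,2)]
    by (auto simp: monoid_semiring_def intro!: eventually_ball_finite)
  then show ?thesis
  proof eventually_elim
    case (elim k)
    then show ?case
      using keys_mult[of "monomial (real k *\<^sub>R m\<^sub>0)" F]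
      by (auto simp: monomial_power monoid_semiring_def split: if_splits)
  qed
qed

lemma kernel_cong_in_U_cong:
  assumes "\<phi> \<in> U_trop p M \<sigma>"
  shows "kernel_cong p M \<sigma> \<phi> \<in> U_cong p M \<sigma>"
proof -
  have \<phi>: "\<phi> 0 = 1" "\<And>a b. a \<in> cone_monoid p M \<sigma> \<Longrightarrow> b \<in> cone_monoid p M \<sigma> \<Longrightarrow> \<phi> (a + b) = \<phi> a * \<phi> b"
    using assms by (auto simp: U_trop_def trop_hom_def)
  have "{(a, b). a \<in> cone_semiring \<sigma> \<and> b \<in> cone_semiring \<sigma> \<and>
      (\<forall>\<^sub>F t in sequentially. eval_trop \<phi> a = eval_trop \<phi> b)} \<in> CSpecT trop_const (cone_semiring \<sigma>)"
    using \<phi> by (intro eventually_equal_in_CSpecT)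
      (auto simp: eval_trop_add eval_trop_const eventually_const_iff intro: eval_trop_mult)
  then show ?thesis by (simp add: kernel_cong_def U_cong_def)
qed

lemma pullback_in_U_cong:
  assumes "\<tau> \<subseteq> \<sigma>" "Q \<in> U_cong p M \<tau>"
  shows "pullback_cong p M \<tau> \<sigma> Q \<in> U_cong p M \<sigma>"
  using CSpecT_restrict[OF subsemiring cone_semiring_antimono[OF assms(1)]] assms(2)
  by (simp add: U_cong_def pullback_cong_def)

end


section \<open>The glued spaces\<close>

lemma glue_rel_invariant:
  assumes "(x, y) \<in> glue_rel I le f U"
    and step: "\<And>x y. (x, y) \<in> glue_step I le f U \<Longrightarrow> Q x \<longleftrightarrow> Q y"
  shows "Q x \<longleftrightarrow> Q y"
proof -
  have "(x, y) \<in> (glue_step I le f U \<union> (glue_step I le f U)\<inverse>)\<^sup>*"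
    using assms(1) by (simp add: glue_rel_def)
  then show ?thesis
    by (induction rule: rtrancl_induct) (auto dest: step)
qed

lemma glue_step_imp_glue_rel:
  "(x, y) \<in> glue_step I le f U \<Longrightarrow> (x, y) \<in> glue_rel I le f U"
  by (auto simp: glue_rel_def glue_step_def)

context dual_bases
begin

lemma openin_U_cong_topology:
  "openin (U_cong_topology p M \<sigma>) W \<longleftrightarrow>
    (\<exists>C. congruence (cone_semiring \<sigma>) C \<and> W = {Q \<in> U_cong p M \<sigma>. \<not> C \<subseteq> Q})"
proof
  assume "openin (U_cong_topology p M \<sigma>) W"
  then obtain T C where "T \<subseteq> CSpec (cone_semiring \<sigma>)" "congruence (cone_semiring \<sigma>) C"
    "CSpec (cone_semiring \<sigma>) - T = VC (cone_semiring \<sigma>) C" "W = T \<inter> U_cong p M \<sigma>"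
    unfolding U_cong_topology_def CSpecT_topology_def U_cong_def
      openin_subtopology openin_CSpec_topology[OF subsemiring] by blast
  moreover have "U_cong p M \<sigma> \<subseteq> CSpec (cone_semiring \<sigma>)" by (auto simp: U_cong_def CSpecT_def)
  ultimately show "\<exists>C. congruence (cone_semiring \<sigma>) C \<and> W = {Q \<in> U_cong p M \<sigma>. \<not> C \<subseteq> Q}"
    unfolding VC_def by (intro exI[of _ C] conjI) auto
next
  assume "\<exists>C. congruence (cone_semiring \<sigma>) C \<and> W = {Q \<in> U_cong p M \<sigma>. \<not> C \<subseteq> Q}"
  then obtain C where C: "congruence (cone_semiring \<sigma>) C" "W = {Q \<in> U_cong p M \<sigma>. \<not> C \<subseteq> Q}"
    by blast
  let ?T = "CSpec (cone_semiring \<sigma>) - VC (cone_semiring \<sigma>) C"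
  have "CSpec (cone_semiring \<sigma>) - ?T = VC (cone_semiring \<sigma>) C" by (auto simp: VC_def)
  moreover have "W = ?T \<inter> U_cong p M \<sigma>"
    unfolding C(2) by (auto simp: VC_def U_cong_def CSpecT_def)
  ultimately show "openin (U_cong_topology p M \<sigma>) W"
    unfolding U_cong_topology_def CSpecT_topology_def U_cong_def
      openin_subtopology openin_CSpec_topology[OF subsemiring] using C(1) by blast
qed

lemma dual_lattices: "dual_lattices n p M N"
  unfolding dual_lattices_def
  by (intro conjI exI[of _ e] exI[of _ f] bilinear M_eq N_eq span_M span_N allI impI dual)

lemma equiv_X_cong_rel: "equiv (Sigma \<Sigma> (U_cong p M)) (X_cong_rel p M \<Sigma>)"
  unfolding X_cong_rel_def by (rule equiv_glue_rel)

lemma X_cong_points_eq: "X_cong_points p M \<Sigma> = Sigma \<Sigma> (U_cong p M) // X_cong_rel p M \<Sigma>"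
  by (simp add: X_cong_points_def X_cong_rel_def glue_def)

lemma openin_X_cong_iff:
  "openin (X_cong p M \<Sigma>) V \<longleftrightarrow> V \<subseteq> X_cong_points p M \<Sigma> \<and>
    (\<forall>\<sigma>\<in>\<Sigma>. openin (U_cong_topology p M \<sigma>) {Q. (\<sigma>, Q) \<in> \<Union>V})"
proof -
  have "\<Union>V \<subseteq> Sigma \<Sigma> (U_cong p M)" if "V \<subseteq> X_cong_points p M \<Sigma>"
    using that Union_quotient[OF equiv_X_cong_rel] unfolding X_cong_points_eq by blast
  then show ?thesis
    using topspace_U_cong_topology[OF dual_lattices]
    by (auto simp: openin_X_cong[OF dual_lattices] openin_sum_topology o_def)
qed

lemma face_subset: "cone_face p \<tau> \<sigma> \<Longrightarrow> \<tau> \<subseteq> \<sigma>"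
  by (auto simp: cone_face_def)

lemma X_cong_rel_pullback:
  assumes "\<tau> \<in> \<Sigma>" "\<sigma> \<in> \<Sigma>" "cone_face p \<tau> \<sigma>" "Q \<in> U_cong p M \<tau>"
  shows "((\<tau>, Q), (\<sigma>, pullback_cong p M \<tau> \<sigma> Q)) \<in> X_cong_rel p M \<Sigma>"
  unfolding X_cong_rel_def
  by (rule glue_step_imp_glue_rel)
     (use assms pullback_in_U_cong[OF face_subset] in \<open>auto simp: glue_step_def\<close>)

text \<open>Open sets of a chart consist of the points not containing some congruence, so they
  are inherited by smaller points.\<close>

lemma X_cong_class_in_closure:
  assumes "\<sigma> \<in> \<Sigma>" "P \<in> U_cong p M \<sigma>" "P\<^sub>0 \<in> U_cong p M \<sigma>" "P \<subseteq> P\<^sub>0"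
  shows "X_cong_rel p M \<Sigma> `` {(\<sigma>, P\<^sub>0)} \<in> X_cong p M \<Sigma> closure_of {X_cong_rel p M \<Sigma> `` {(\<sigma>, P)}}"
  unfolding in_closure_of
proof (intro conjI allI impI)
  let ?R = "X_cong_rel p M \<Sigma>"
  show "?R `` {(\<sigma>, P\<^sub>0)} \<in> topspace (X_cong p M \<Sigma>)"
    using assms by (simp add: topspace_X_cong[OF dual_lattices] X_cong_points_eq quotientI)
  fix V assume V: "?R `` {(\<sigma>, P\<^sub>0)} \<in> V \<and> openin (X_cong p M \<Sigma>) V"
  then obtain C where "{Q. (\<sigma>, Q) \<in> \<Union>V} = {Q \<in> U_cong p M \<sigma>. \<not> C \<subseteq> Q}"
    using assms(1) by (auto simp: openin_X_cong_iff openin_U_cong_topology)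
  moreover have "(\<sigma>, P\<^sub>0) \<in> \<Union>V"
    using V equiv_class_self[OF equiv_X_cong_rel, of "(\<sigma>, P\<^sub>0)" \<Sigma>] assms by blast
  ultimately have "(\<sigma>, P) \<in> \<Union>V" using assms(2,4) by blast
  then obtain c where c: "c \<in> V" "(\<sigma>, P) \<in> c" by blast
  then have "c \<in> Sigma \<Sigma> (U_cong p M) // ?R"
    using V by (auto simp: openin_X_cong_iff X_cong_points_eq)
  then obtain x where x: "c = ?R `` {x}" by (rule quotientE)
  then have "(x, (\<sigma>, P)) \<in> ?R" using c(2) by simp
  then have "c = ?R `` {(\<sigma>, P)}" unfolding x by (rule equiv_class_eq[OF equiv_X_cong_rel])
  then show "\<exists>y. y \<in> {?R `` {(\<sigma>, P)}} \<and> y \<in> V" using c(1) by blast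
qed

text \<open>Containing \<open>C \<sigma>\<close> is a closed condition in the chart of \<open>\<sigma>\<close>, and compatibility makes it
  independent of the chart. So it defines a closed subset of the glued space, which contains the
  closure of each of its points.\<close>

lemma closure_of_compatible_family:
  assumes C: "\<And>\<sigma>. \<sigma> \<in> \<Sigma> \<Longrightarrow> C \<sigma> \<in> U_cong p M \<sigma>"
    and compatible: "\<And>\<tau> \<sigma> Q. \<tau> \<in> \<Sigma> \<Longrightarrow> \<sigma> \<in> \<Sigma> \<Longrightarrow> cone_face p \<tau> \<sigma> \<Longrightarrow> Q \<in> U_cong p M \<tau> \<Longrightarrow>
      C \<tau> \<subseteq> Q \<longleftrightarrow> C \<sigma> \<subseteq> pullback_cong p M \<tau> \<sigma> Q"
    and \<sigma>: "\<sigma> \<in> \<Sigma>" and c: "c \<in> X_cong p M \<Sigma> closure_of {X_cong_rel p M \<Sigma> `` {(\<sigma>, C \<sigma>)}}"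
    and Q: "(\<sigma>', Q) \<in> c"
  shows "C \<sigma>' \<subseteq> Q"
proof -
  let ?R = "X_cong_rel p M \<Sigma>"
  have invariant: "C (fst x) \<subseteq> snd x \<longleftrightarrow> C (fst y) \<subseteq> snd y" if "(x, y) \<in> ?R" for x y
    using that unfolding X_cong_rel_def
  proof (rule glue_rel_invariant)
    fix x y assume "(x, y) \<in> glue_step \<Sigma> (cone_face p) (pullback_cong p M) (U_cong p M)"
    then show "C (fst x) \<subseteq> snd x \<longleftrightarrow> C (fst y) \<subseteq> snd y"
      using compatible[of "fst x" "fst y" "snd x"] unfolding glue_step_def by force
  qed
  define V where "V = {d \<in> X_cong_points p M \<Sigma>. \<forall>x\<in>d. \<not> C (fst x) \<subseteq> snd x}"
  have "{Q. (\<tau>, Q) \<in> \<Union>V} = {Q \<in> U_cong p M \<tau>. \<not> C \<tau> \<subseteq> Q}" if "\<tau> \<in> \<Sigma>" for \<tau>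
  proof (intro set_eqI iffI)
    fix Q assume "Q \<in> {Q. (\<tau>, Q) \<in> \<Union>V}"
    then obtain d where d: "d \<in> V" "(\<tau>, Q) \<in> d" by blast
    then have "(\<tau>, Q) \<in> Sigma \<Sigma> (U_cong p M)"
      using Union_quotient[OF equiv_X_cong_rel] unfolding V_def X_cong_points_eq by blast
    moreover have "\<not> C (fst (\<tau>, Q)) \<subseteq> snd (\<tau>, Q)" using d unfolding V_def by blast
    ultimately show "Q \<in> {Q \<in> U_cong p M \<tau>. \<not> C \<tau> \<subseteq> Q}" by simp
  next
    fix Q assume Q: "Q \<in> {Q \<in> U_cong p M \<tau>. \<not> C \<tau> \<subseteq> Q}"
    then have "(\<tau>, Q) \<in> Sigma \<Sigma> (U_cong p M)" using \<open>\<tau> \<in> \<Sigma>\<close> by simp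
    then have "(\<tau>, Q) \<in> ?R `` {(\<tau>, Q)}" "?R `` {(\<tau>, Q)} \<in> X_cong_points p M \<Sigma>"
      using equiv_class_self[OF equiv_X_cong_rel] by (auto simp: X_cong_points_eq quotientI)
    moreover have "\<forall>x\<in>?R `` {(\<tau>, Q)}. \<not> C (fst x) \<subseteq> snd x" using invariant Q by fastforce
    ultimately show "Q \<in> {Q. (\<tau>, Q) \<in> \<Union>V}" unfolding V_def by blast
  qed
  moreover have "congruence (cone_semiring \<tau>) (C \<tau>)" if "\<tau> \<in> \<Sigma>" for \<tau>
    using C[OF that] CSpecT_congruence by (simp add: U_cong_def)
  ultimately have "openin (X_cong p M \<Sigma>) V"
    unfolding openin_X_cong_iff openin_U_cong_topology V_def by blast
  moreover have "?R `` {(\<sigma>, C \<sigma>)} \<notin> V"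
    using equiv_class_self[OF equiv_X_cong_rel, of "(\<sigma>, C \<sigma>)" \<Sigma>] \<sigma> C
    by (force simp: V_def)
  ultimately have "c \<notin> V" using c by (auto simp: in_closure_of)
  moreover have "c \<in> X_cong_points p M \<Sigma>"
    using c by (simp add: in_closure_of topspace_X_cong[OF dual_lattices])
  ultimately obtain x where x: "x \<in> c" "C (fst x) \<subseteq> snd x" by (auto simp: V_def)
  have "(x, (\<sigma>', Q)) \<in> ?R"
    using \<open>c \<in> X_cong_points p M \<Sigma>\<close> x(1) Q quotient_eq_iff[OF equiv_X_cong_rel]
    unfolding X_cong_points_eq by metis
  then show ?thesis using invariant x(2) by fastforce
qed

lemma kernel_cong_restrict:
  assumes "\<tau> \<subseteq> \<sigma>"
  shows "kernel_cong p M \<sigma> (restrict_trop p M \<tau> \<sigma> \<phi>) = pullback_cong p M \<tau> \<sigma> (kernel_cong p M \<tau> \<phi>)"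
proof -
  have "eval_trop (restrict_trop p M \<tau> \<sigma> \<phi>) F = eval_trop \<phi> F" if "F \<in> cone_semiring \<sigma>" for F
    unfolding eval_trop_def
    by (rule sum.cong) (use that in \<open>auto simp: restrict_trop_def monoid_semiring_def\<close>)
  then show ?thesis
    using cone_semiring_antimono[OF assms] by (auto simp: kernel_cong_def pullback_cong_def)
qed

text \<open>By \<open>kernel_cong_restrict\<close> the kernels of related homomorphisms are related, so that all
  representatives of \<open>x\<close> contribute the same class.\<close>

lemma trop_to_cong_class:
  assumes x: "x \<in> X_trop p M \<Sigma>" "(\<sigma>, \<phi>) \<in> x"
  shows "\<sigma> \<in> \<Sigma>" "\<phi> \<in> U_trop p M \<sigma>"
    and "trop_to_cong p M \<Sigma> x = X_cong_rel p M \<Sigma> `` {(\<sigma>, kernel_cong p M \<sigma> \<phi>)}"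
proof -
  let ?T = "glue_rel \<Sigma> (cone_face p) (restrict_trop p M) (U_trop p M)"
  let ?R = "X_cong_rel p M \<Sigma>"
  define K where "K = (\<lambda>(\<sigma>, \<phi>). (\<sigma>, kernel_cong p M \<sigma> \<phi>))"
  have "x \<in> Sigma \<Sigma> (U_trop p M) // ?T" using x(1) by (simp add: X_trop_def glue_def)
  then have rel: "((\<sigma>, \<phi>), y) \<in> ?T" if "y \<in> x" for y
    using that x(2) quotient_eq_iff[OF equiv_glue_rel] by metis
  show mem: "\<sigma> \<in> \<Sigma>" "\<phi> \<in> U_trop p M \<sigma>" using rel[OF x(2)] by (auto simp: glue_rel_def)
  have "(K (\<sigma>, \<phi>), K y) \<in> ?R" if "y \<in> x" for y
  proof -
    have self: "(K (\<sigma>, \<phi>), K (\<sigma>, \<phi>)) \<in> ?R"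
      using equiv_class_self[OF equiv_X_cong_rel, of "K (\<sigma>, \<phi>)" \<Sigma>] mem kernel_cong_in_U_cong
      by (auto simp: K_def)
    have "(K a, K b) \<in> ?R"
      if "(a, b) \<in> glue_step \<Sigma> (cone_face p) (restrict_trop p M) (U_trop p M)" for a b
      using that X_cong_rel_pullback kernel_cong_in_U_cong kernel_cong_restrict[OF face_subset]
      by (auto simp: glue_step_def K_def)
    then have "(K (\<sigma>, \<phi>), K a) \<in> ?R \<longleftrightarrow> (K (\<sigma>, \<phi>), K b) \<in> ?R"
      if "(a, b) \<in> glue_step \<Sigma> (cone_face p) (restrict_trop p M) (U_trop p M)" for a b
      using that equiv_X_cong_rel[of \<Sigma>] unfolding equiv_def by (meson symD transD)
    then show ?thesis
      using glue_rel_invariant[OF rel[OF that], of "\<lambda>a. (K (\<sigma>, \<phi>), K a) \<in> ?R"] self by blast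
  qed
  then have "?R `` (K ` x) = ?R `` {K (\<sigma>, \<phi>)}"
    using x(2) equiv_class_eq[OF equiv_X_cong_rel[of \<Sigma>]] by blast
  then show "trop_to_cong p M \<Sigma> x = ?R `` {(\<sigma>, kernel_cong p M \<sigma> \<phi>)}"
    by (simp add: trop_to_cong_def K_def)
qed

lemma kernel_class_in_image:
  assumes "\<sigma> \<in> \<Sigma>" "\<phi> \<in> U_trop p M \<sigma>"
  shows "X_cong_rel p M \<Sigma> `` {(\<sigma>, kernel_cong p M \<sigma> \<phi>)} \<in> trop_to_cong p M \<Sigma> ` X_trop p M \<Sigma>"
proof -
  let ?T = "glue_rel \<Sigma> (cone_face p) (restrict_trop p M) (U_trop p M)"
  have "?T `` {(\<sigma>, \<phi>)} \<in> X_trop p M \<Sigma>"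
    unfolding X_trop_def glue_def using assms by (intro quotientI) simp
  moreover have "(\<sigma>, \<phi>) \<in> ?T `` {(\<sigma>, \<phi>)}"
    using equiv_class_self[OF equiv_glue_rel] assms by (metis mem_Sigma_iff)
  ultimately show ?thesis using trop_to_cong_class(3) by (metis imageI)
qed

end


section \<open>Complete fans: every point specialises to a tropical point\<close>

context dual_bases
begin

text \<open>The exponents of the monomials that are nonzero modulo \<open>P\<close> form a face of the monoid
  \<open>M\<^sub>\<sigma>\<close>. For each generator of \<open>\<sigma>\<close> pick such an exponent that is positive there, if there is
  one; the sum of the choices lies in the relative interior of the face.\<close>

lemma nonzero_monomials_face:
  assumes \<sigma>: "rational_cone N \<sigma>" and P: "P \<in> U_cong p M \<sigma>"
  obtains m\<^sub>0 where "m\<^sub>0 \<in> cone_monoid p M \<sigma>" "(monomial m\<^sub>0, 0) \<notin> P"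
    "\<And>m v. m \<in> cone_monoid p M \<sigma> \<Longrightarrow> (monomial m, 0) \<notin> P \<Longrightarrow> v \<in> \<sigma> \<Longrightarrow> p m\<^sub>0 v = 0 \<Longrightarrow> p m v = 0"
proof -
  interpret P: tropical_prime "cone_semiring \<sigma>" trop_const P
    by standard (use P in \<open>simp add: U_cong_def\<close>)
  obtain G where G: "finite G" "G \<subseteq> N" "G \<subseteq> \<sigma>"
    "\<sigma> = {\<Sum>g\<in>G. c g *\<^sub>R g | c. \<forall>g\<in>G. 0 \<le> c g}"
    "dual_cone p \<sigma> = {u. \<forall>g\<in>G. 0 \<le> p u g}"
    by (rule cone_generators[OF \<sigma>])
  define F where "F = {m \<in> cone_monoid p M \<sigma>. (monomial m, 0) \<notin> P}"
  have "(monomial 0, 0) \<notin> P"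
    using P.const_inj[of 1 0] by (auto simp: trop_const_def)
  then have F_0: "0 \<in> F" by (simp add: F_def cone_monoid_0)
  have F_add: "a + b \<in> F" if "a \<in> F" "b \<in> F" for a b
    using that P.cancel[of "monomial a" "monomial b" 0] closed(1)
    by (auto simp: F_def cone_monoid_add monomial_mem monomial_mult)
  have nonneg: "0 \<le> p m g" if "m \<in> F" "g \<in> G" for m g
    using that G(5) by (auto simp: F_def cone_monoid_def)
  have "\<exists>m\<in>F. 0 < p m g \<or> (\<forall>m'\<in>F. p m' g \<le> 0)" for g
    using F_0 by (metis not_le)
  then obtain c where c: "\<And>g. c g \<in> F" "\<And>g. 0 < p (c g) g \<or> (\<forall>m\<in>F. p m g \<le> 0)" by metis
  define m\<^sub>0 where "m\<^sub>0 = (\<Sum>g\<in>G. c g)"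
  have "(\<Sum>g\<in>K. c g) \<in> F" if "finite K" for K
    using that by (induction K rule: finite_induct) (auto simp: F_0 F_add c)
  then have "m\<^sub>0 \<in> F" using G(1) by (simp add: m\<^sub>0_def)
  have vanish: "p m g = 0" if "m \<in> F" "g \<in> G" "p m\<^sub>0 g = 0" for m g
  proof -
    have "(\<Sum>h\<in>G. p (c h) g) = 0" using that(3) by (simp add: m\<^sub>0_def pairing_simps)
    then have "p (c g) g = 0"
      using G(1) nonneg c(1) \<open>g \<in> G\<close> by (simp add: sum_nonneg_eq_0_iff)
    then show ?thesis using c(2)[of g] nonneg[OF that(1,2)] that(1) by force
  qed
  show ?thesis
  proof
    show "m\<^sub>0 \<in> cone_monoid p M \<sigma>" "(monomial m\<^sub>0, 0) \<notin> P" using \<open>m\<^sub>0 \<in> F\<close> by (auto simp: F_def)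
    fix m v assume m: "m \<in> cone_monoid p M \<sigma>" "(monomial m, 0) \<notin> P" and v: "v \<in> \<sigma>" "p m\<^sub>0 v = 0"
    then have "m \<in> F" by (simp add: F_def)
    obtain a where a: "\<forall>g\<in>G. 0 \<le> a g" "v = (\<Sum>g\<in>G. a g *\<^sub>R g)" using v(1) G(4) by auto
    then have "\<forall>g\<in>G. a g = 0 \<or> p m\<^sub>0 g = 0"
      using v(2) pairing_combination_eq_0_iff[of G a m\<^sub>0] G(1) nonneg[OF \<open>m\<^sub>0 \<in> F\<close>] by simp
    then show "p m v = 0"
      using a pairing_combination_eq_0_iff[of G a m] G(1) nonneg[OF \<open>m \<in> F\<close>] vanish[OF \<open>m \<in> F\<close>]
      by auto
  qed
qed

text \<open>Localising at the monomial \<open>m\<^sub>0\<close> of the preceding lemma, every point is seen to come from the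
  chart of a face \<open>\<tau>\<close>, in which the monomials not perpendicular to \<open>\<tau>\<close> vanish.\<close>

lemma point_extends_to_face:
  assumes \<sigma>: "rational_cone N \<sigma>" and P: "P \<in> U_cong p M \<sigma>"
  obtains \<tau> Q where "cone_face p \<tau> \<sigma>" "Q \<in> U_cong p M \<tau>" "pullback_cong p M \<tau> \<sigma> Q = P"
    "\<And>m v. m \<in> cone_monoid p M \<tau> \<Longrightarrow> v \<in> \<tau> \<Longrightarrow> p m v \<noteq> 0 \<Longrightarrow> (monomial m, 0) \<in> Q"
proof -
  interpret P: tropical_prime "cone_semiring \<sigma>" trop_const P
    by standard (use P in \<open>simp add: U_cong_def\<close>)
  obtain m\<^sub>0 where m\<^sub>0: "m\<^sub>0 \<in> cone_monoid p M \<sigma>" "(monomial m\<^sub>0, 0) \<notin> P"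
    and perp: "\<And>m v. m \<in> cone_monoid p M \<sigma> \<Longrightarrow> (monomial m, 0) \<notin> P \<Longrightarrow> v \<in> \<sigma> \<Longrightarrow> p m\<^sub>0 v = 0 \<Longrightarrow> p m v = 0"
    using nonzero_monomials_face[OF \<sigma> P] by metis
  define \<tau> where "\<tau> = {v \<in> \<sigma>. p m\<^sub>0 v = 0}"
  define Q where "Q = {(f, g). f \<in> cone_semiring \<tau> \<and> g \<in> cone_semiring \<tau> \<and>
    (\<exists>k. (monomial m\<^sub>0 ^ k * f, monomial m\<^sub>0 ^ k * g) \<in> P)}"
  have "\<tau> \<subseteq> \<sigma>" by (auto simp: \<tau>_def)
  have reach: "\<exists>k. monomial m\<^sub>0 ^ k * f \<in> cone_semiring \<sigma>" if "f \<in> cone_semiring \<tau>" for f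
    using eventually_in_cone_semiring[OF \<sigma> m\<^sub>0(1), of f] that
    by (auto simp: \<tau>_def eventually_sequentially)
  note loc = P.localisation[OF subsemiring cone_semiring_antimono[OF \<open>\<tau> \<subseteq> \<sigma>\<close>]
    monomial_mem[OF m\<^sub>0(1)] m\<^sub>0(2) reach, folded Q_def]
  show ?thesis
  proof
    show "cone_face p \<tau> \<sigma>"
      using m\<^sub>0(1) by (auto simp: cone_face_def \<tau>_def cone_monoid_def)
    show "Q \<in> U_cong p M \<tau>" using loc(1) by (simp add: U_cong_def)
    show "pullback_cong p M \<tau> \<sigma> Q = P" using loc(2) by (simp add: pullback_cong_def)
    fix m v assume m: "m \<in> cone_monoid p M \<tau>" and v: "v \<in> \<tau>" "p m v \<noteq> 0"
    obtain k where k: "real k *\<^sub>R m\<^sub>0 + m \<in> cone_monoid p M \<sigma>"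
      using eventually_in_cone_monoid[OF \<sigma> m\<^sub>0(1), of m] m
      by (auto simp: \<tau>_def eventually_sequentially)
    have "p (real k *\<^sub>R m\<^sub>0 + m) v \<noteq> 0" using v by (simp add: \<tau>_def pairing_simps)
    then have "(monomial (real k *\<^sub>R m\<^sub>0 + m), 0) \<in> P"
      using perp[OF k, of v] v by (auto simp: \<tau>_def)
    then have "(monomial m\<^sub>0 ^ k * monomial m, monomial m\<^sub>0 ^ k * 0) \<in> P"
      by (simp add: monomial_power monomial_mult)
    then show "(monomial m, 0) \<in> Q"
      unfolding Q_def using monomial_mem[OF m] closed(1) by blast
  qed
qed

text \<open>An unbounded monomial is at least \<open>1\<close>. If \<open>m j\<close> occurs in a relation, then \<open>- m j\<close> is a sum of
  exponents of monomials that are at least \<open>1\<close>, so that \<open>m j\<close> itself is bounded by \<open>1\<close>.\<close>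

lemma no_relation_of_unbounded_monomials:
  assumes Q: "tropical_prime (cone_semiring \<tau>) trop_const Q" and "finite I"
    and m: "\<And>i. i \<in> I \<Longrightarrow> m i \<in> cone_monoid p M \<tau>"
    and unbounded: "\<And>i. i \<in> I \<Longrightarrow> tropical_prime.upper trop_const Q (monomial (m i)) = {}"
    and relation: "(\<Sum>i\<in>I. real (k i) *\<^sub>R m i) = 0" and j: "j \<in> I" "0 < k j"
  shows False
proof -
  interpret Q: tropical_prime "cone_semiring \<tau>" trop_const Q by (rule Q)
  define B where "B = {a \<in> cone_monoid p M \<tau>. Q.le 1 (monomial a)}"
  have B_0: "0 \<in> B" using Q.le_refl closed(2) by (simp add: B_def cone_monoid_0)
  have B_add: "a + b \<in> B" if "a \<in> B" "b \<in> B" for a b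
    using that Q.le_mult[of 1 1 "monomial a" "monomial b"] closed(2)
    by (simp add: B_def cone_monoid_add monomial_mult)
  have B_multiple: "real l *\<^sub>R a \<in> B" if "a \<in> B" for a l
    by (induction l) (use that B_0 B_add in \<open>auto simp: scaleR_add_left\<close>)
  have B_m: "m i \<in> B" if "i \<in> I" for i
  proof -
    have "\<not> Q.le (monomial (m i)) (trop_const (Fin 0))"
      using unbounded[OF that] by (auto simp: Q.upper_def)
    then show ?thesis
      using Q.le_total[OF monomial_mem[OF m[OF that]] closed(2)] m[OF that]
      by (auto simp: B_def monomial_zero[symmetric])
  qed
  define k' where "k' = k(j := k j - 1)"
  define b where "b = (\<Sum>i\<in>I. real (k' i) *\<^sub>R m i)"
  have "(\<Sum>i\<in>K. real (k' i) *\<^sub>R m i) \<in> B" if "finite K" "K \<subseteq> I" for K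
    using that by (induction K rule: finite_induct) (auto simp: B_0 intro!: B_add B_multiple B_m)
  then have "b \<in> B" using \<open>finite I\<close> by (simp add: b_def)
  have "(\<Sum>i\<in>I. real (k i) *\<^sub>R m i) = m j + b"
    using \<open>finite I\<close> j by (simp add: b_def k'_def sum.remove[of I j] scaleR_left_diff_distrib of_nat_diff)
  then have "m j + b = 0" using relation by simp
  moreover have "trop_const (Fin 0) = (1 :: 'w \<Rightarrow>\<^sub>0 trop)" using \<iota>_1 by (simp add: one_trop_def)
  ultimately have "Q.le (monomial (m j)) (trop_const (Fin 0))"
    using Q.le_mult[of "monomial (m j)" 1 "monomial (m j)" "monomial b"] \<open>b \<in> B\<close>
      monomial_mem[OF m[OF j(1)]] Q.le_refl closed(2)
    by (simp add: B_def monomial_mult)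
  then show False using unbounded[OF j(1)] by (auto simp: Q.upper_def)
qed

text \<open>If each cone \<open>\<sigma>' \<supseteq> \<tau>\<close> had an unbounded monomial, Gordan's theorem would
  give a direction \<open>v\<close> on which all of these exponents are positive. Moving from a point \<open>w\<close> in
  the relative interior of \<open>\<tau>\<close> a little against \<open>v\<close>, one would leave all cones that contain
  \<open>\<tau>\<close> without reaching any other cone.\<close>

lemma complete_fan_cone_with_bounded_monomials:
  assumes fan: "fan p N \<Sigma>" and complete: "complete_fan \<Sigma>" and "\<tau> \<in> \<Sigma>"
    and Q: "tropical_prime (cone_semiring \<tau>) trop_const Q"
    and vanish: "\<And>m v. m \<in> cone_monoid p M \<tau> \<Longrightarrow> v \<in> \<tau> \<Longrightarrow> p m v \<noteq> 0 \<Longrightarrow> (monomial m, 0) \<in> Q"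
  obtains \<sigma> where "\<sigma> \<in> \<Sigma>" "\<tau> \<subseteq> \<sigma>"
    "\<And>m. m \<in> cone_monoid p M \<sigma> \<Longrightarrow> tropical_prime.upper trop_const Q (monomial m) \<noteq> {}"
proof (rule ccontr)
  note cone_found = that
  assume "\<not> thesis"
  then have no_cone: "\<exists>m\<in>cone_monoid p M \<sigma>. tropical_prime.upper trop_const Q (monomial m) = {}"
    if "\<sigma> \<in> \<Sigma>" "\<tau> \<subseteq> \<sigma>" for \<sigma>
    using that cone_found by blast
  interpret Q: tropical_prime "cone_semiring \<tau>" trop_const Q by (rule Q)
  define I where "I = {\<sigma> \<in> \<Sigma>. \<tau> \<subseteq> \<sigma>}"
  have "finite I" using fan by (simp add: I_def fan_def)
  obtain m where m: "\<And>\<sigma>. \<sigma> \<in> I \<Longrightarrow> m \<sigma> \<in> cone_monoid p M \<sigma>"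
    "\<And>\<sigma>. \<sigma> \<in> I \<Longrightarrow> Q.upper (monomial (m \<sigma>)) = {}"
    using no_cone unfolding I_def mem_Collect_eq by metis
  have m_\<tau>: "m \<sigma> \<in> cone_monoid p M \<tau>" if "\<sigma> \<in> I" for \<sigma>
    using m(1)[OF that] cone_monoid_antimono[of \<tau> \<sigma>] that by (auto simp: I_def)
  obtain v where v: "\<And>\<sigma>. \<sigma> \<in> I \<Longrightarrow> 0 < p (m \<sigma>) v"
  proof (rule Gordan[OF \<open>finite I\<close>, of m])
    fix c j
    assume c: "\<And>\<sigma>. \<sigma> \<in> I \<Longrightarrow> 0 \<le> c \<sigma>" "(\<Sum>\<sigma>\<in>I. c \<sigma> *\<^sub>R m \<sigma>) = 0" "j \<in> I" "0 < c j"
    have "m \<sigma> \<in> M" if "\<sigma> \<in> I" for \<sigma> using m_\<tau>[OF that] by (simp add: cone_monoid_def)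
    then obtain k :: "'v set \<Rightarrow> nat" where "(\<Sum>\<sigma>\<in>I. real (k \<sigma>) *\<^sub>R m \<sigma>) = 0" "0 < k j"
      using integral_relation[OF \<open>finite I\<close> _ c] by metis
    then show False
      using no_relation_of_unbounded_monomials[OF Q \<open>finite I\<close>, of m k j] m_\<tau> m(2) c(3) by blast
  qed blast
  have "rational_cone N \<tau>" using fan \<open>\<tau> \<in> \<Sigma>\<close> by (simp add: fan_def)
  obtain G where G: "finite G" "G \<subseteq> N" "G \<subseteq> \<tau>"
    "\<tau> = {\<Sum>g\<in>G. c g *\<^sub>R g | c. \<forall>g\<in>G. 0 \<le> c g}"
    "dual_cone p \<tau> = {u. \<forall>g\<in>G. 0 \<le> p u g}"
    by (rule cone_generators[OF \<open>rational_cone N \<tau>\<close>])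
  \<comment> \<open>\<open>w\<close> lies in the relative interior of \<open>\<tau>\<close>: a cone that contains it contains \<open>\<tau>\<close>.\<close>
  define w where "w = (\<Sum>g\<in>G. 1 *\<^sub>R g)"
  have "w \<in> \<tau>" unfolding w_def G(4) by (intro CollectI exI[of _ "\<lambda>_. 1"]) simp
  have interior: "\<tau> \<subseteq> \<sigma>" if "\<sigma> \<in> \<Sigma>" "w \<in> \<sigma>" for \<sigma>
  proof -
    have "cone_face p (\<tau> \<inter> \<sigma>) \<tau>" using fan \<open>\<tau> \<in> \<Sigma>\<close> that(1) unfolding fan_def by blast
    then obtain u where u: "u \<in> dual_cone p \<tau>" "\<tau> \<inter> \<sigma> = {x \<in> \<tau>. p u x = 0}"
      unfolding cone_face_def by blast
    have "p u w = 0" using u(2) \<open>w \<in> \<tau>\<close> that(2) by blast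
    moreover have "\<forall>g\<in>G. 0 \<le> p u g" using u(1)[unfolded G(5)] by simp
    ultimately have vanish_G: "\<forall>g\<in>G. p u g = 0"
      using pairing_combination_eq_0_iff[of G "\<lambda>_. 1" u] G(1) unfolding w_def by simp
    have "p u x = 0" if "x \<in> \<tau>" for x
    proof -
      obtain c where "x = (\<Sum>g\<in>G. c g *\<^sub>R g)" using \<open>x \<in> \<tau>\<close>[unfolded G(4)] by blast
      then show ?thesis using vanish_G by (simp add: pairing_simps)
    qed
    then show ?thesis using u(2) by blast
  qed
  have "\<forall>\<^sub>F \<epsilon> in at_right 0. w - \<epsilon> *\<^sub>R v \<notin> \<sigma>" if "\<sigma> \<in> \<Sigma>" for \<sigma>
  proof (cases "\<sigma> \<in> I")
    case True
    have perp: "p (m \<sigma>) w = 0"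
    proof (rule ccontr)
      assume "p (m \<sigma>) w \<noteq> 0"
      then have "(monomial (m \<sigma>), 0) \<in> Q" using vanish m_\<tau>[OF True] \<open>w \<in> \<tau>\<close> by blast
      then have "Q.upper 0 \<subseteq> Q.upper (monomial (m \<sigma>))"
        using Q.upper_antimono Q.le_of_congruent monomial_mem[OF m_\<tau>[OF True]] by blast
      moreover have "0 \<in> Q.upper 0" using Q.zero_le \<iota>_mem by (simp add: Q.upper_def)
      ultimately show False using m(2)[OF True] by blast
    qed
    have "\<forall>\<^sub>F \<epsilon> in at_right 0. 0 < (\<epsilon>::real)" by (rule eventually_at_right_less)
    then show ?thesis
    proof eventually_elim
      case (elim \<epsilon>)
      then have "p (m \<sigma>) (w - \<epsilon> *\<^sub>R v) < 0" using v[OF True] perp by (simp add: pairing_simps)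
      then show ?case using m(1)[OF True] by (auto simp: cone_monoid_def dual_cone_def)
    qed
  next
    case False
    then have "w \<notin> \<sigma>" using interior that by (auto simp: I_def)
    moreover have "rational_cone N \<sigma>" using fan that by (simp add: fan_def)
    ultimately obtain u where u: "u \<in> cone_monoid p M \<sigma>" "p u w < 0"
      using cone_monoid_separates by blast
    have "((\<lambda>\<epsilon>. p u w - \<epsilon> * p u v) \<longlongrightarrow> p u w - 0 * p u v) (at_right 0)"
      by (intro tendsto_intros)
    then have "\<forall>\<^sub>F \<epsilon> in at_right 0. p u w - \<epsilon> * p u v < 0"
      using order_tendstoD(2)[where a = 0] u(2) by fastforce
    then show ?thesis
    proof eventually_elim
      case (elim \<epsilon>)
      then have "p u (w - \<epsilon> *\<^sub>R v) < 0" by (simp add: pairing_simps)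
      then show ?case using u(1) by (auto simp: cone_monoid_def dual_cone_def)
    qed
  qed
  then have "\<forall>\<^sub>F \<epsilon> in at_right 0. \<forall>\<sigma>\<in>\<Sigma>. w - \<epsilon> *\<^sub>R v \<notin> \<sigma>"
    using fan by (intro eventually_ball_finite) (auto simp: fan_def)
  then obtain \<epsilon> where "\<forall>\<sigma>\<in>\<Sigma>. w - \<epsilon> *\<^sub>R v \<notin> \<sigma>"
    using eventually_happens trivial_limit_at_right_real by blast
  then show False using complete by (auto simp: complete_fan_def)
qed

text \<open>If all monomials are bounded by constants, the order on the quotient determines a multiplicative
  map to \<open>\<T>\<close>, sending a polynomial to the infimum of the constants above it.\<close>

lemma bounded_point_below_kernel_cong:
  assumes P: "P \<in> U_cong p M \<sigma>"
    and bounded: "\<And>m. m \<in> cone_monoid p M \<sigma> \<Longrightarrow> tropical_prime.upper trop_const P (monomial m) \<noteq> {}"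
  obtains \<phi> where "\<phi> \<in> U_trop p M \<sigma>" "P \<subseteq> kernel_cong p M \<sigma> \<phi>"
proof -
  interpret P: tropical_prime "cone_semiring \<sigma>" trop_const P
    by standard (use P in \<open>simp add: U_cong_def\<close>)
  define \<phi> where "\<phi> = restrict (\<lambda>m. P.valuation (monomial m)) (cone_monoid p M \<sigma>)"
  have term_bounded: "P.upper (Poly_Mapping.single m r) \<noteq> {} \<and>
      P.valuation (Poly_Mapping.single m r) = r * \<phi> m"
    if m: "m \<in> cone_monoid p M \<sigma>" for m r
  proof -
    have const: "P.upper (trop_const r) \<noteq> {}"
    proof (cases r)
      case NegInf
      then show ?thesis
        using P.zero_le \<iota>_mem \<iota>_0 by (auto simp: P.upper_def zero_trop_def)
    next
      case (Fin x)
      then show ?thesis using P.le_refl \<iota>_mem by (auto simp: P.upper_def)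
    qed
    then obtain x y where "P.le (trop_const r) (trop_const (Fin x))"
      "P.le (monomial m) (trop_const (Fin y))"
      using bounded[OF m] by (auto simp: P.upper_def)
    then have "P.le (Poly_Mapping.single m r) (trop_const (Fin (x + y)))"
      using P.le_mult[OF \<iota>_mem monomial_mem[OF m]]
      by (metis const_times_monomial \<iota>_mult times_trop.simps(1))
    then have "P.upper (Poly_Mapping.single m r) \<noteq> {}" by (auto simp: P.upper_def)
    moreover have "P.valuation (trop_const r * monomial m) = r * \<phi> m"
      using P.valuation_mult[OF \<iota>_mem monomial_mem[OF m] const bounded[OF m]] m
      by (simp add: P.valuation_const \<phi>_def)
    ultimately show ?thesis by (simp add: const_times_monomial)
  qed
  have eval: "P.upper F \<noteq> {} \<and> P.valuation F = eval_trop \<phi> F" if "F \<in> cone_semiring \<sigma>" for F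
    using that
  proof (induction F rule: monoid_semiring_induct)
    case zero
    then show ?case using term_bounded[OF cone_monoid_0, of 0] by (simp add: eval_trop_zero)
  next
    case (single m r)
    then show ?case using term_bounded by (simp add: eval_trop_single)
  next
    case (add F G)
    obtain x y where xy: "P.le F (trop_const (Fin x))" "P.le G (trop_const (Fin y))"
      using add.IH by (auto simp: P.upper_def)
    have "P.le F (trop_const (Fin (max x y)))" "P.le G (trop_const (Fin (max x y)))"
      using xy P.le_trans add.hyps P.const_le_iff by (meson max.cobounded1 max.cobounded2)+
    then have "P.le (F + G) (trop_const (Fin (max x y)))" using P.add_le add.hyps by blast
    then show ?case
      using P.valuation_add[OF add.hyps] add.IH by (auto simp: P.upper_def eval_trop_add)
  qed
  show ?thesis
  proof
    have "P.valuation 1 = 1" using P.valuation_const[of 1] \<iota>_1 by simp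
    moreover have "P.valuation (monomial (a + b)) = P.valuation (monomial a) * P.valuation (monomial b)"
      if "a \<in> cone_monoid p M \<sigma>" "b \<in> cone_monoid p M \<sigma>" for a b
      using P.valuation_mult[OF monomial_mem[OF that(1)] monomial_mem[OF that(2)]] bounded that
      by (simp add: monomial_mult)
    ultimately show "\<phi> \<in> U_trop p M \<sigma>"
      by (simp add: U_trop_def trop_hom_def \<phi>_def cone_monoid_0 cone_monoid_add)
    show "P \<subseteq> kernel_cong p M \<sigma> \<phi>"
      using P.mem P.valuation_congruent eval by (fastforce simp: kernel_cong_def)
  qed
qed

end


section \<open>Incomplete fans: a point without tropical specialisations\<close>

lemma affine_eventually_compare:
  fixes a b c d :: real
  shows "(\<forall>\<^sub>F t in at_top. a * t + b < c * t + d) \<or> (a = c \<and> b = d) \<or>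
    (\<forall>\<^sub>F t in at_top. c * t + d < a * t + b)"
proof -
  have *: "\<forall>\<^sub>F t in at_top. a * t + b < c * t + d" if "a < c" for a b c d :: real
    using eventually_gt_at_top[of "(b - d) / (c - a)"]
    by eventually_elim (use that in \<open>simp add: field_simps\<close>)
  show ?thesis
    using *[of a c b d] *[of c a d b] by (cases a c rule: linorder_cases; cases b d rule: linorder_cases) auto
qed

context dual_bases
begin

definition ray_eval :: "'v \<Rightarrow> real \<Rightarrow> ('w \<Rightarrow>\<^sub>0 trop) \<Rightarrow> trop" where
  "ray_eval v t = eval_trop (\<lambda>m. Fin (- p m v * t))"

text \<open>Comparing tropical polynomials along the ray of evaluations \<open>m \<mapsto> - t \<langle>m, v\<rangle>\<close>, \<open>t \<rightarrow> \<infinity>\<close>,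
  amounts to comparing them in the lexicographic semifield \<open>\<real>\<^sup>2 \<union> {-\<infinity>}\<close>: first by the
  slope and then by the constant term.\<close>

definition ray_congruence :: "'v \<Rightarrow> 'v set \<Rightarrow> (('w \<Rightarrow>\<^sub>0 trop) \<times> ('w \<Rightarrow>\<^sub>0 trop)) set" where
  "ray_congruence v \<sigma> = {(F, G). F \<in> cone_semiring \<sigma> \<and> G \<in> cone_semiring \<sigma> \<and>
    (\<forall>\<^sub>F t in at_top. ray_eval v t F = ray_eval v t G)}"

lemma ray_eval_add: "ray_eval v t (F + G) = ray_eval v t F + ray_eval v t G"
  by (simp add: ray_eval_def eval_trop_add)

lemma ray_eval_mult: "ray_eval v t (F * G) = ray_eval v t F * ray_eval v t G"
  unfolding ray_eval_def
  by (rule eval_trop_mult[where A = UNIV]) (simp_all add: monoid_semiring_def pairing_simps algebra_simps)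

lemma ray_eval_const: "ray_eval v t (trop_const r) = r"
  by (simp add: ray_eval_def eval_trop_const pairing_simps one_trop_def)

lemma ray_eval_eventually_affine:
  "(\<forall>t. ray_eval v t F = NegInf) \<or>
   (\<exists>a b. \<forall>\<^sub>F t in at_top. ray_eval v t F = Fin (a * t + b))"
proof -
  have "F \<in> monoid_semiring UNIV" by (simp add: monoid_semiring_def)
  then show ?thesis
  proof (induction F rule: monoid_semiring_induct)
    case zero
    then show ?case by (simp add: ray_eval_def eval_trop_zero zero_trop_def)
  next
    case (single m r)
    show ?case
    proof (cases r)
      case NegInf
      then show ?thesis by (simp add: ray_eval_def eval_trop_single)
    next
      case (Fin x)
      then have "\<forall>\<^sub>F t in at_top. ray_eval v t (Poly_Mapping.single m r) = Fin ((- p m v) * t + x)"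
        by (simp add: ray_eval_def eval_trop_single)
      then show ?thesis by blast
    qed
  next
    case (add F G)
    show ?case
    proof (cases "(\<forall>t. ray_eval v t F = NegInf) \<or> (\<forall>t. ray_eval v t G = NegInf)")
      case True
      moreover have "r + NegInf = r" for r by (cases r) auto
      ultimately show ?thesis using add.IH by (auto simp: ray_eval_add)
    next
      case False
      then obtain a b c d where F: "\<forall>\<^sub>F t in at_top. ray_eval v t F = Fin (a * t + b)"
        and G: "\<forall>\<^sub>F t in at_top. ray_eval v t G = Fin (c * t + d)" using add.IH by blast
      have "(\<forall>\<^sub>F t in at_top. a * t + b \<le> c * t + d) \<or> (\<forall>\<^sub>F t in at_top. c * t + d \<le> a * t + b)"
        using affine_eventually_compare[of a b c d]
          eventually_mono[of "\<lambda>t. a * t + b < c * t + d" at_top "\<lambda>t. a * t + b \<le> c * t + d"]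
          eventually_mono[of "\<lambda>t. c * t + d < a * t + b" at_top "\<lambda>t. c * t + d \<le> a * t + b"]
        by auto
      then show ?thesis
      proof
        assume "\<forall>\<^sub>F t in at_top. a * t + b \<le> c * t + d"
        with F G have "\<forall>\<^sub>F t in at_top. ray_eval v t (F + G) = Fin (c * t + d)"
          by eventually_elim (simp add: ray_eval_add)
        then show ?thesis by blast
      next
        assume "\<forall>\<^sub>F t in at_top. c * t + d \<le> a * t + b"
        with F G have "\<forall>\<^sub>F t in at_top. ray_eval v t (F + G) = Fin (a * t + b)"
          by eventually_elim (simp add: ray_eval_add)
        then show ?thesis by blast
      qed
    qed
  qed
qed

lemma ray_eval_dichotomy:
  "(\<forall>\<^sub>F t in at_top. ray_eval v t F = ray_eval v t G) \<or>
   (\<forall>\<^sub>F t in at_top. ray_eval v t F \<noteq> ray_eval v t G)"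
proof -
  consider "\<forall>t. ray_eval v t F = NegInf" | "\<forall>t. ray_eval v t G = NegInf"
    | a b c d where "\<forall>\<^sub>F t in at_top. ray_eval v t F = Fin (a * t + b)"
      "\<forall>\<^sub>F t in at_top. ray_eval v t G = Fin (c * t + d)"
    using ray_eval_eventually_affine[of v F] ray_eval_eventually_affine[of v G] by blast
  then show ?thesis
  proof cases
    case 1
    from ray_eval_eventually_affine[of v G] show ?thesis
    proof (elim disjE exE)
      fix a b assume "\<forall>\<^sub>F t in at_top. ray_eval v t G = Fin (a * t + b)"
      then have "\<forall>\<^sub>F t in at_top. ray_eval v t F \<noteq> ray_eval v t G"
        by eventually_elim (simp add: 1)
      then show ?thesis ..
    qed (simp add: 1)
  next
    case 2
    from ray_eval_eventually_affine[of v F] show ?thesis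
    proof (elim disjE exE)
      fix a b assume "\<forall>\<^sub>F t in at_top. ray_eval v t F = Fin (a * t + b)"
      then have "\<forall>\<^sub>F t in at_top. ray_eval v t F \<noteq> ray_eval v t G"
        by eventually_elim (simp add: 2)
      then show ?thesis ..
    qed (simp add: 2)
  next
    case 3
    from affine_eventually_compare[of a b c d] show ?thesis
    proof (elim disjE)
      assume "\<forall>\<^sub>F t in at_top. a * t + b < c * t + d"
      with 3 have "\<forall>\<^sub>F t in at_top. ray_eval v t F \<noteq> ray_eval v t G" by eventually_elim simp
      then show ?thesis ..
    next
      assume "a = c \<and> b = d"
      then have "\<forall>\<^sub>F t in at_top. ray_eval v t F = ray_eval v t G"
        using eventually_conj[OF 3] by (auto elim: eventually_mono)
      then show ?thesis ..
    next
      assume "\<forall>\<^sub>F t in at_top. c * t + d < a * t + b"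
      with 3 have "\<forall>\<^sub>F t in at_top. ray_eval v t F \<noteq> ray_eval v t G" by eventually_elim simp
      then show ?thesis ..
    qed
  qed
qed

lemma ray_congruence_in_U_cong: "ray_congruence v \<sigma> \<in> U_cong p M \<sigma>"
  unfolding U_cong_def ray_congruence_def
  by (rule eventually_equal_in_CSpecT)
     (simp_all add: ray_eval_add ray_eval_mult ray_eval_const ray_eval_dichotomy)

text \<open>The monomial of a lattice normal \<open>m\<^sub>0\<close> of the face is a unit in the chart of \<open>\<tau>\<close>, and
  multiplying by a power of it moves any relation into the chart of \<open>\<sigma>\<close>.\<close>

lemma ray_congruence_compatible:
  assumes \<sigma>: "rational_cone N \<sigma>" and face: "cone_face p \<tau> \<sigma>" and Q: "Q \<in> U_cong p M \<tau>"
  shows "ray_congruence v \<tau> \<subseteq> Q \<longleftrightarrow> ray_congruence v \<sigma> \<subseteq> pullback_cong p M \<tau> \<sigma> Q"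
proof
  assume "ray_congruence v \<tau> \<subseteq> Q"
  then show "ray_congruence v \<sigma> \<subseteq> pullback_cong p M \<tau> \<sigma> Q"
    using cone_semiring_antimono[OF face_subset[OF face]]
    by (auto simp: ray_congruence_def pullback_cong_def)
next
  assume sub: "ray_congruence v \<sigma> \<subseteq> pullback_cong p M \<tau> \<sigma> Q"
  obtain m\<^sub>0 where m\<^sub>0: "m\<^sub>0 \<in> cone_monoid p M \<sigma>" and \<tau>: "\<tau> = {x \<in> \<sigma>. p m\<^sub>0 x = 0}"
    using face_lattice_normal[OF \<sigma> face] by metis
  have Q_congr: "congruence (cone_semiring \<tau>) Q"
    using Q CSpecT_congruence by (simp add: U_cong_def)
  show "ray_congruence v \<tau> \<subseteq> Q"
  proof (rule subrelI)
    fix F G assume FG: "(F, G) \<in> ray_congruence v \<tau>"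
    then have "F \<in> cone_semiring \<tau>" "G \<in> cone_semiring \<tau>" by (auto simp: ray_congruence_def)
    then have "\<forall>\<^sub>F k in sequentially. monomial m\<^sub>0 ^ k * F \<in> cone_semiring \<sigma> \<and>
        monomial m\<^sub>0 ^ k * G \<in> cone_semiring \<sigma>"
      using eventually_in_cone_semiring[OF \<sigma> m\<^sub>0] unfolding \<tau> by (simp add: eventually_conj)
    then obtain k where k: "monomial m\<^sub>0 ^ k * F \<in> cone_semiring \<sigma>" "monomial m\<^sub>0 ^ k * G \<in> cone_semiring \<sigma>"
      by (auto simp: eventually_sequentially)
    then have "(monomial m\<^sub>0 ^ k * F, monomial m\<^sub>0 ^ k * G) \<in> ray_congruence v \<sigma>"
      using FG by (auto simp: ray_congruence_def ray_eval_mult elim: eventually_mono)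
    then have Q1: "(monomial m\<^sub>0 ^ k * F, monomial m\<^sub>0 ^ k * G) \<in> Q"
      using sub by (auto simp: pullback_cong_def)
    have "- (real k *\<^sub>R m\<^sub>0) \<in> cone_monoid p M \<tau>"
      using m\<^sub>0 by (auto simp: cone_monoid_def dual_cone_def \<tau> pairing_simps M_uminus M_multiple)
    then have "(monomial (- (real k *\<^sub>R m\<^sub>0)), monomial (- (real k *\<^sub>R m\<^sub>0))) \<in> Q"
      using congruence_refl[OF Q_congr] monomial_mem by blast
    from congruence_mult[OF Q_congr this Q1] show "(F, G) \<in> Q"
      by (simp add: monomial_power monomial_mult flip: mult.assoc)
  qed
qed

text \<open>A monomial whose exponent is negative on \<open>v\<close> exceeds all constants modulo the ray congruence, so a
  tropical specialisation would have to give it the value \<open>+\<infinity>\<close>.\<close>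

lemma ray_congruence_not_below_kernel_cong:
  assumes "rational_cone N \<sigma>" "v \<notin> \<sigma>" "\<phi> \<in> U_trop p M \<sigma>"
  shows "\<not> ray_congruence v \<sigma> \<subseteq> kernel_cong p M \<sigma> \<phi>"
proof
  assume sub: "ray_congruence v \<sigma> \<subseteq> kernel_cong p M \<sigma> \<phi>"
  obtain m where m: "m \<in> cone_monoid p M \<sigma>" "p m v < 0"
    using cone_monoid_separates[OF assms(1,2)] by blast
  have absorbed: "\<phi> m + Fin x = \<phi> m" for x
  proof -
    have "\<forall>\<^sub>F t in at_top. x \<le> - p m v * t"
      using eventually_ge_at_top[of "x / (- p m v)"]
      by eventually_elim (use m(2) in \<open>simp add: field_simps\<close>)
    then have "\<forall>\<^sub>F t in at_top. ray_eval v t (monomial m + trop_const (Fin x)) = ray_eval v t (monomial m)"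
    proof eventually_elim
      case (elim t)
      then show ?case
        by (simp add: ray_eval_add ray_eval_const) (simp add: ray_eval_def eval_trop_single)
    qed
    then have "(monomial m + trop_const (Fin x), monomial m) \<in> ray_congruence v \<sigma>"
      using monomial_mem[OF m(1)] \<iota>_mem closed(3) by (simp add: ray_congruence_def)
    then have "(monomial m + trop_const (Fin x), monomial m) \<in> kernel_cong p M \<sigma> \<phi>"
      using sub by blast
    moreover have "\<phi> 0 = 1" using assms(3) by (simp add: U_trop_def trop_hom_def)
    ultimately show ?thesis
      by (simp add: kernel_cong_def eval_trop_add eval_trop_const eval_trop_single)
  qed
  show False
  proof (cases "\<phi> m")
    case NegInf
    then show False using absorbed[of 0] by simp
  next
    case (Fin y)
    then show False using absorbed[of "y + 1"] by simp
  qed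
qed

end


section \<open>The equivalence\<close>

context dual_bases
begin

text \<open>The given point is moved to the chart of the face \<open>\<tau>\<close> on which its monomials live and from
  there to the chart of a cone \<open>\<sigma>' \<supseteq> \<tau>\<close> in which all monomials are bounded.\<close>

lemma complete_fan_point_specialises:
  assumes fan: "fan p N \<Sigma>" and complete: "complete_fan \<Sigma>"
    and \<sigma>: "\<sigma> \<in> \<Sigma>" and P: "P \<in> U_cong p M \<sigma>"
  obtains \<sigma>' \<phi> where "\<sigma>' \<in> \<Sigma>" "\<phi> \<in> U_trop p M \<sigma>'"
    "X_cong_rel p M \<Sigma> `` {(\<sigma>', kernel_cong p M \<sigma>' \<phi>)} \<in>
      X_cong p M \<Sigma> closure_of {X_cong_rel p M \<Sigma> `` {(\<sigma>, P)}}"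
proof -
  let ?R = "X_cong_rel p M \<Sigma>"
  have "rational_cone N \<sigma>" using fan \<sigma> by (simp add: fan_def)
  then obtain \<tau> Q where \<tau>: "cone_face p \<tau> \<sigma>" and Q: "Q \<in> U_cong p M \<tau>"
    "pullback_cong p M \<tau> \<sigma> Q = P"
    and vanish: "\<And>m v. m \<in> cone_monoid p M \<tau> \<Longrightarrow> v \<in> \<tau> \<Longrightarrow> p m v \<noteq> 0 \<Longrightarrow> (monomial m, 0) \<in> Q"
    using point_extends_to_face[OF _ P] by metis
  have "\<tau> \<in> \<Sigma>" using fan \<sigma> \<tau> unfolding fan_def by blast
  interpret Q: tropical_prime "cone_semiring \<tau>" trop_const Q
    by standard (use Q(1) in \<open>simp add: U_cong_def\<close>)
  obtain \<sigma>' where \<sigma>': "\<sigma>' \<in> \<Sigma>" "\<tau> \<subseteq> \<sigma>'"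
    and bounded: "\<And>m. m \<in> cone_monoid p M \<sigma>' \<Longrightarrow> Q.upper (monomial m) \<noteq> {}"
    using complete_fan_cone_with_bounded_monomials[OF fan complete \<open>\<tau> \<in> \<Sigma>\<close>
        Q.tropical_prime_axioms] vanish by metis
  define P' where "P' = pullback_cong p M \<tau> \<sigma>' Q"
  have P': "P' \<in> U_cong p M \<sigma>'" unfolding P'_def by (rule pullback_in_U_cong[OF \<sigma>'(2) Q(1)])
  interpret P': tropical_prime "cone_semiring \<sigma>'" trop_const P'
    by standard (use P' in \<open>simp add: U_cong_def\<close>)
  have "P'.upper (monomial m) \<noteq> {}" if m: "m \<in> cone_monoid p M \<sigma>'" for m
  proof -
    obtain x where "Q.le (monomial m) (trop_const (Fin x))"
      using bounded[OF m] by (auto simp: Q.upper_def)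
    then have "(monomial m + trop_const (Fin x), trop_const (Fin x)) \<in> P'"
      using monomial_mem[OF m] \<iota>_mem closed(3)
      by (simp add: Q.le_def P'_def pullback_cong_def)
    then show ?thesis by (auto simp: P'.upper_def P'.le_def)
  qed
  then obtain \<phi> where \<phi>: "\<phi> \<in> U_trop p M \<sigma>'" "P' \<subseteq> kernel_cong p M \<sigma>' \<phi>"
    using bounded_point_below_kernel_cong[OF P'] by metis
  have "\<tau> \<inter> \<sigma>' = \<tau>" using \<sigma>'(2) by blast
  then have "cone_face p \<tau> \<sigma>'" using fan \<open>\<tau> \<in> \<Sigma>\<close> \<sigma>'(1) unfolding fan_def by metis
  then have "?R `` {(\<tau>, Q)} = ?R `` {(\<sigma>', P')}"
    unfolding P'_def
    by (intro equiv_class_eq[OF equiv_X_cong_rel] X_cong_rel_pullback \<open>\<tau> \<in> \<Sigma>\<close> \<sigma>'(1) Q(1))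
  moreover have "?R `` {(\<tau>, Q)} = ?R `` {(\<sigma>, P)}"
    using X_cong_rel_pullback[OF \<open>\<tau> \<in> \<Sigma>\<close> \<sigma> \<tau> Q(1)] unfolding Q(2)
    by (rule equiv_class_eq[OF equiv_X_cong_rel])
  moreover have "?R `` {(\<sigma>', kernel_cong p M \<sigma>' \<phi>)} \<in> X_cong p M \<Sigma> closure_of {?R `` {(\<sigma>', P')}}"
    by (rule X_cong_class_in_closure[OF \<sigma>'(1) P' kernel_cong_in_U_cong[OF \<phi>(1)] \<phi>(2)])
  ultimately show ?thesis using that[OF \<sigma>'(1) \<phi>(1)] by simp
qed

lemma incomplete_fan_point_without_specialisation:
  assumes fan: "fan p N \<Sigma>" and incomplete: "\<not> complete_fan \<Sigma>"
  obtains P where "P \<in> topspace (X_cong p M \<Sigma>)"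
    "\<forall>x\<in>X_trop p M \<Sigma>. trop_to_cong p M \<Sigma> x \<notin> X_cong p M \<Sigma> closure_of {P}"
proof -
  obtain v where v: "\<And>\<sigma>. \<sigma> \<in> \<Sigma> \<Longrightarrow> v \<notin> \<sigma>" using incomplete by (auto simp: complete_fan_def)
  have rational: "rational_cone N \<sigma>" if "\<sigma> \<in> \<Sigma>" for \<sigma> using fan that by (simp add: fan_def)
  obtain \<sigma> where \<sigma>: "\<sigma> \<in> \<Sigma>" using fan by (auto simp: fan_def)
  define P where "P = X_cong_rel p M \<Sigma> `` {(\<sigma>, ray_congruence v \<sigma>)}"
  show ?thesis
  proof
    show "P \<in> topspace (X_cong p M \<Sigma>)"
      using \<sigma> ray_congruence_in_U_cong
      by (simp add: P_def topspace_X_cong[OF dual_lattices] X_cong_points_eq quotientI)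
    show "\<forall>x\<in>X_trop p M \<Sigma>. trop_to_cong p M \<Sigma> x \<notin> X_cong p M \<Sigma> closure_of {P}"
    proof (intro ballI notI)
      fix x assume x: "x \<in> X_trop p M \<Sigma>"
        and closure: "trop_to_cong p M \<Sigma> x \<in> X_cong p M \<Sigma> closure_of {P}"
      obtain \<sigma>' \<phi> where "(\<sigma>', \<phi>) \<in> x"
        using x in_quotient_imp_non_empty[OF equiv_glue_rel] unfolding X_trop_def glue_def by fast
      note x' = trop_to_cong_class[OF x this]
      have "(\<sigma>', kernel_cong p M \<sigma>' \<phi>) \<in> trop_to_cong p M \<Sigma> x"
        unfolding x'(3) using x'(1,2) kernel_cong_in_U_cong
        by (intro equiv_class_self[OF equiv_X_cong_rel]) simp
      then have "ray_congruence v \<sigma>' \<subseteq> kernel_cong p M \<sigma>' \<phi>"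
        using closure_of_compatible_family[of \<Sigma> "ray_congruence v", OF ray_congruence_in_U_cong
            ray_congruence_compatible[OF rational] \<sigma> closure[unfolded P_def]]
        by blast
      then show False
        using ray_congruence_not_below_kernel_cong[OF rational[OF x'(1)] v[OF x'(1)] x'(2)] by blast
    qed
  qed
qed

end

theorem theorem6p13:
  fixes n :: nat
    and p :: "'w::real_vector \<Rightarrow> 'v::real_vector \<Rightarrow> real"
    and M :: "'w set" and N :: "'v set" and \<Sigma> :: "'v set set"
  assumes "dual_lattices n p M N"
    and "fan p N \<Sigma>"
  shows "(\<forall>P\<in>topspace (X_cong p M \<Sigma>). \<exists>P0\<in>trop_to_cong p M \<Sigma> ` X_trop p M \<Sigma>.
            P0 \<in> X_cong p M \<Sigma> closure_of {P})
         \<longleftrightarrow> complete_fan \<Sigma>"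
proof -
  have "\<exists>e f. dual_bases n p M N e f"
    using assms(1) unfolding dual_lattices_def dual_bases_def
    by (elim conjE exE, intro exI conjI allI impI) (assumption | simp)+
  then obtain e f where ef: "dual_bases n p M N e f" by blast
  interpret dual_bases n p M N e f by (rule ef)
  show ?thesis
  proof
    assume specialises: "\<forall>P\<in>topspace (X_cong p M \<Sigma>).
      \<exists>P0\<in>trop_to_cong p M \<Sigma> ` X_trop p M \<Sigma>. P0 \<in> X_cong p M \<Sigma> closure_of {P}"
    show "complete_fan \<Sigma>"
    proof (rule ccontr)
      assume "\<not> complete_fan \<Sigma>"
      then obtain P where "P \<in> topspace (X_cong p M \<Sigma>)"
        "\<forall>x\<in>X_trop p M \<Sigma>. trop_to_cong p M \<Sigma> x \<notin> X_cong p M \<Sigma> closure_of {P}"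
        by (rule incomplete_fan_point_without_specialisation[OF assms(2)])
      then show False using specialises by blast
    qed
  next
    assume complete: "complete_fan \<Sigma>"
    show "\<forall>P\<in>topspace (X_cong p M \<Sigma>). \<exists>P0\<in>trop_to_cong p M \<Sigma> ` X_trop p M \<Sigma>.
      P0 \<in> X_cong p M \<Sigma> closure_of {P}"
    proof
      fix P assume "P \<in> topspace (X_cong p M \<Sigma>)"
      then obtain \<sigma> P' where "\<sigma> \<in> \<Sigma>" "P' \<in> U_cong p M \<sigma>" and P: "P = X_cong_rel p M \<Sigma> `` {(\<sigma>, P')}"
        unfolding topspace_X_cong[OF assms(1)] X_cong_points_eq by (auto elim!: quotientE)
      then obtain \<sigma>' \<phi> where \<phi>: "\<sigma>' \<in> \<Sigma>" "\<phi> \<in> U_trop p M \<sigma>'"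
        and closure: "X_cong_rel p M \<Sigma> `` {(\<sigma>', kernel_cong p M \<sigma>' \<phi>)} \<in>
          X_cong p M \<Sigma> closure_of {P}"
        using complete_fan_point_specialises[OF assms(2) complete] by metis
      show "\<exists>P0\<in>trop_to_cong p M \<Sigma> ` X_trop p M \<Sigma>. P0 \<in> X_cong p M \<Sigma> closure_of {P}"
        by (rule bexI[rotated], rule kernel_class_in_image[OF \<phi>], rule closure)
    qed
  qed
qed

end
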